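(* There is an absolute constant $C$ such that the following holds. Consider a diagonal-compliant or wide-compliant web CA, started from a uniformly random binary seed $\xi_0$ on $[0,L]$. With probability converging to $1$ as $L\to\infty$, the configuration of $\xi$ in the forward cone of $[0,L]\times\{\lfloor C\log L\rfloor\}$ is unchanged if any set of $0$s in $\xi_0$ are changed to $2$s. If, in addition, the CA has no spontaneous birth, then with probability converging to $1$ as $L\to\infty$ the same cone contains no $2$s.
   Context: All intervals are subsets of $\mathbb Z$. A (3-state, range-2) cellular automaton (CA) rule is a function $f:\{0,1,2\}^5\to\{0,1,2\}$; from $\xi_0\in\{0,1,2\}^{\mathbb Z}$ it evolves by $\xi_{t+1}(x)=f(\xi_t(x-2),\xi_t(x-1),\xi_t(x),\xi_t(x+1),\xi_t(x+2))$, $t=0,1,2,\dots$. Write $\xi(x,t)=\xi_t(x)$. Let $\delta(a)=\mathbf 1[a=1]$. The rule $f$ is a web CA if $f(0,0,0,0,0)=0$ and $\delta(f(a,b,c,d,e))=\delta(b)+\delta(c)+\delta(d) \bmod 2$ for all $a,b,c,d,e\in\{0,1,2\}$. Below $a,\dots,e,a',\dots,e'\in\{0,1,2\}$ are arbitrary subject to $\delta(a)=\delta(a'),\dots,\delta(e)=\delta(e')$; put $\ell=\delta(a)+\delta(b)+\delta(c)\bmod 2$ and $r=\delta(c)+\delta(d)+\delta(e)\bmod 2$. - $f$ is empty-compliant if always $f(a,b,c,d,e)=f(a',b,c,d,e')$. - $f$ is diagonal-compliant if always $f(a,b,c,d,e)=f(a',b,c',d,e')$. - $f$ is wide-compliant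 if it is empty-compliant and: $c=r=1$ implies $f(a,b,c,d,e)=f(a',b,c,d',e')$; and $c=\ell=1$ implies $f(a,b,c,d,e)=f(a',b',c,d,e')$. The rule has no spontaneous birth if whenever $\xi_0$ contains no $2$s, $\xi_1$ also contains no $2$s. A uniformly random binary seed on $[0,L]$ is a $\xi_0$ where $\xi_0(x)$, $x\in[0,L]$, are independent taking values $0,1$ with probability $1/2$ each, and $\xi_0(x)=0$ for $x\notin[0,L]$. The forward cone of a space–time point $(x,t)\in\mathbb Z\times[0,\infty)$ is $\{(y,s):|y-x|\le s-t\}$; the forward cone of a set is the union of the forward cones of its points. *)

theory Defs
  imports "HOL-Probability.Probability" "HOL-Probability.Product_PMF"
begin

datatype state = S0 | S1 | S2

type_synonym rule5 = "state \<Rightarrow> state \<Rightarrow> state \<Rightarrow> state \<Rightarrow> state \<Rightarrow> state"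

type_synonym configuration = "int \<Rightarrow> state"

definition ca_step :: "rule5 \<Rightarrow> configuration \<Rightarrow> configuration" where
  "ca_step f \<xi> = (\<lambda>x. f (\<xi> (x - 2)) (\<xi> (x - 1)) (\<xi> x) (\<xi> (x + 1)) (\<xi> (x + 2)))"

primrec evolve :: "rule5 \<Rightarrow> configuration \<Rightarrow> nat \<Rightarrow> configuration" where
  "evolve f \<xi> 0 = \<xi>"
| "evolve f \<xi> (Suc t) = ca_step f (evolve f \<xi> t)"

definition \<delta> :: "state \<Rightarrow> nat" where
  "\<delta> a = of_bool (a = S1)"

definition web_CA :: "rule5 \<Rightarrow> bool" where
  "web_CA f \<longleftrightarrow> f S0 S0 S0 S0 S0 = S0 \<and>
    (\<forall>a b c d e. \<delta> (f a b c d e) = (\<delta> b + \<delta> c + \<delta> d) mod 2)"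

definition empty_compliant :: "rule5 \<Rightarrow> bool" where
  "empty_compliant f \<longleftrightarrow>
    (\<forall>a b c d e a' e'. \<delta> a = \<delta> a' \<longrightarrow> \<delta> e = \<delta> e' \<longrightarrow>
       f a b c d e = f a' b c d e')"

definition diagonal_compliant :: "rule5 \<Rightarrow> bool" where
  "diagonal_compliant f \<longleftrightarrow>
    (\<forall>a b c d e a' c' e'. \<delta> a = \<delta> a' \<longrightarrow> \<delta> c = \<delta> c' \<longrightarrow> \<delta> e = \<delta> e' \<longrightarrow>
       f a b c d e = f a' b c' d e')"

text \<open>The two sums modulo 2 are \<open>r\<close> and \<open>l\<close>, the images under \<open>\<delta>\<close> of the next states of the right and
  left neighbours of the cell in state \<open>c\<close>.\<close>

definition wide_compliant :: "rule5 \<Rightarrow> bool" where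
  "wide_compliant f \<longleftrightarrow> empty_compliant f \<and>
    (\<forall>a b c d e a' d' e'. \<delta> a = \<delta> a' \<longrightarrow> \<delta> d = \<delta> d' \<longrightarrow> \<delta> e = \<delta> e' \<longrightarrow>
       c = S1 \<longrightarrow> (\<delta> c + \<delta> d + \<delta> e) mod 2 = 1 \<longrightarrow>
       f a b c d e = f a' b c d' e') \<and>
    (\<forall>a b c d e a' b' e'. \<delta> a = \<delta> a' \<longrightarrow> \<delta> b = \<delta> b' \<longrightarrow> \<delta> e = \<delta> e' \<longrightarrow>
       c = S1 \<longrightarrow> (\<delta> a + \<delta> b + \<delta> c) mod 2 = 1 \<longrightarrow>
       f a b c d e = f a' b' c d e')"

definition no_spontaneous_birth :: "rule5 \<Rightarrow> bool" where
  "no_spontaneous_birth f \<longleftrightarrow>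
    (\<forall>\<xi>. (\<forall>x. \<xi> x \<noteq> S2) \<longrightarrow> (\<forall>x. evolve f \<xi> 1 x \<noteq> S2))"

text \<open>The second argument of \<open>Pi_pmf\<close> is the value taken outside the index set, so sampled
  configurations are defined on all integers and equal \<open>S0\<close> off the seed interval.\<close>

definition random_binary_seed :: "nat \<Rightarrow> configuration pmf" where
  "random_binary_seed L = Pi_pmf {0..int L} S0 (\<lambda>_. pmf_of_set {S0, S1})"

definition put_twos :: "int set \<Rightarrow> configuration \<Rightarrow> configuration" where
  "put_twos D \<xi> = (\<lambda>x. if x \<in> D then S2 else \<xi> x)"

definition point_cone :: "int \<times> nat \<Rightarrow> (int \<times> nat) set" where
  "point_cone = (\<lambda>(x, t). {(y, s). \<bar>y - x\<bar> \<le> int s - int t})"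

definition forward_cone :: "(int \<times> nat) set \<Rightarrow> (int \<times> nat) set" where
  "forward_cone A = (\<Union>p\<in>A. point_cone p)"

end

theory Submission
  imports Defs
begin

text \<open>The 1s evolve by the additive rule \<open>xor3\<close> whether or not 0s are replaced by 2s, so a discrepancy
  between the two evolutions can be traced back to time 0 along a path of cells that are not 1
  (steps \<open>\<plusminus>1\<close> in the diagonal case; wide paths otherwise). In a uniformly random configuration such a path
  survives \<open>n\<close> steps with exponentially small probability. A path into the cone that starts near or
  outside an end of the seed must cross a strip along the corresponding edge of the light cone of the
  seed. There the configuration at every time is again uniform, because \<open>xor3\<close> is triangular from the
  edge, and it is periodic in time with period \<open>O(n)\<close>, because \<open>xor3\<close> iterated \<open>2 ^ m\<close> times is
  \<open>xor3\<close> with spacing \<open>2 ^ m\<close>. So a union bound over \<open>O(L + n)\<close> starting points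
  suffices, and \<open>n\<close> may be taken of order \<open>log L\<close>.\<close>

section \<open>Uniform configurations under the additive rule\<close>

definition xor3 :: "(int \<Rightarrow> bool) \<Rightarrow> int \<Rightarrow> bool" where
  "xor3 g x \<longleftrightarrow> (g (x - 1) \<noteq> (g x \<noteq> g (x + 1)))"

type_synonym move = "(int \<Rightarrow> bool) \<Rightarrow> int \<Rightarrow> int \<Rightarrow> bool"

definition diag_move :: move where
  "diag_move g x z \<longleftrightarrow> \<bar>z - x\<bar> = 1"

text \<open>In a \<open>move\<close> the configuration is the one before the step. A diagonal wide step is blocked by two
  1s at the other two corners of the unit square that it crosses.\<close>

definition wide_move :: move where
  "wide_move g x z \<longleftrightarrow> z = x \<or> \<bar>z - x\<bar> = 1 \<and> \<not> (g z \<and> xor3 g x)"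

text \<open>Unfolded at the first move, so that everything after it is an event about
  \<open>xor3 g\<close>. In this shape the estimates for fixed bits of \<open>g\<close>
  apply.\<close>

primrec survives :: "move \<Rightarrow> nat \<Rightarrow> (int \<Rightarrow> bool) \<Rightarrow> int \<Rightarrow> bool" where
  "survives mv 0 g x \<longleftrightarrow> \<not> g x"
| "survives mv (Suc n) g x \<longleftrightarrow> \<not> g x \<and> (\<exists>z. mv g x z \<and> survives mv n (xor3 g) z)"

text \<open>Such an event has the same value on \<open>g\<close> and on \<open>cut a b g\<close>,
  which carries it from bi-infinite configurations to a finite sample space.\<close>

definition depends_on :: "((int \<Rightarrow> bool) \<Rightarrow> bool) \<Rightarrow> int \<Rightarrow> int \<Rightarrow> bool" where
  "depends_on E a b \<longleftrightarrow> (\<forall>g h. (\<forall>x. a \<le> x \<and> x \<le> b \<longrightarrow> g x = h x) \<longrightarrow> E g = E h)"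

definition cut :: "int \<Rightarrow> int \<Rightarrow> (int \<Rightarrow> bool) \<Rightarrow> int \<Rightarrow> bool" where
  "cut a b g = (\<lambda>x. a \<le> x \<and> x \<le> b \<and> g x)"

definition windows :: "int \<Rightarrow> int \<Rightarrow> (int \<Rightarrow> bool) set" where
  "windows a b = {g. \<forall>x. g x \<longrightarrow> a \<le> x \<and> x \<le> b}"

definition fair :: "int \<Rightarrow> int \<Rightarrow> (int \<Rightarrow> bool) pmf" where
  "fair a b = pmf_of_set (windows a b)"

lemma windows_PiE_dflt: "windows a b = PiE_dflt {a..b} False (\<lambda>_. UNIV)"
  by (auto simp: windows_def PiE_dflt_def)

lemma fair_Pi_pmf: "fair a b = Pi_pmf {a..b} False (\<lambda>_. pmf_of_set UNIV)"
  unfolding fair_def windows_PiE_dflt by (subst Pi_pmf_of_set) auto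

lemma finite_windows [simp]: "finite (windows a b)"
  unfolding windows_PiE_dflt by (rule finite_PiE_dflt) auto

lemma windows_nonempty [simp]: "windows a b \<noteq> {}"
proof -
  have "(\<lambda>_. False) \<in> windows a b" by (simp add: windows_def)
  then show ?thesis by blast
qed

lemma card_windows: "card (windows a b) = 2 ^ nat (b - a + 1)"
  unfolding windows_PiE_dflt by (subst card_PiE_dflt) auto

lemma cut_in_windows [simp]: "cut a b g \<in> windows a b"
  by (simp add: cut_def windows_def)

lemma prob_fair: "measure_pmf.prob (fair a b) {g. E g}
    = real (card {g \<in> windows a b. E g}) / 2 ^ nat (b - a + 1)"
proof -
  have "windows a b \<inter> {g. E g} = {g \<in> windows a b. E g}" by blast
  then show ?thesis
    by (simp add: fair_def measure_pmf_of_set card_windows)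
qed

section \<open>Fixed bits and the next configuration\<close>

text \<open>The relation at an interior cell can be solved for either neighbour, so two adjacent
  bits propagate up to \<open>hi\<close> and down to \<open>lo\<close>. Each new bit needs the
  previous two, hence the two-step inductions.\<close>

lemma xor3_determines:
  assumes X: "\<And>x. lo < x \<Longrightarrow> x < hi \<Longrightarrow> xor3 g x = xor3 h x"
    and y: "lo \<le> y" "y + 1 \<le> hi" "g y = h y" "g (y + 1) = h (y + 1)"
    and x: "lo \<le> x" "x \<le> hi"
  shows "g x = h x"
proof -
  have up: "y + int k \<le> hi \<Longrightarrow> g (y + int k) = h (y + int k)" for k
  proof (induction k rule: induct_nat_012)
    case (ge2 n)
    have e: "y + int (Suc (Suc n)) = y + int (Suc n) + 1"
        "y + int n = y + int (Suc n) - 1" by auto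
    have "g (y + int (Suc n)) = h (y + int (Suc n))" "g (y + int n) = h (y + int n)"
      "xor3 g (y + int (Suc n)) = xor3 h (y + int (Suc n))"
      using ge2 y X[of "y + int (Suc n)"] by auto
    then show ?case unfolding xor3_def e by blast
  qed (use y in auto)
  have down: "lo \<le> y + 1 - int k \<Longrightarrow> g (y + 1 - int k) = h (y + 1 - int k)" for k
  proof (induction k rule: induct_nat_012)
    case (ge2 n)
    have e: "y + 1 - int (Suc (Suc n)) = y + 1 - int (Suc n) - 1"
        "y + 1 - int n = y + 1 - int (Suc n) + 1" by auto
    have "g (y + 1 - int (Suc n)) = h (y + 1 - int (Suc n))" "g (y + 1 - int n) = h (y + 1 - int n)"
      "xor3 g (y + 1 - int (Suc n)) = xor3 h (y + 1 - int (Suc n))"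
      using ge2 y X[of "y + 1 - int (Suc n)"] by auto
    then show ?case unfolding xor3_def e by blast
  qed (use y in auto)
  show ?thesis
  proof (cases "y \<le> x")
    case True
    then show ?thesis using up[of "nat (x - y)"] x by simp
  next
    case False
    then show ?thesis using down[of "nat (y + 1 - x)"] x by simp
  qed
qed

text \<open>With two adjacent bits fixed, \<open>xor3\<close> is injective into the window shortened
  by one cell at each end. That window has a quarter as many configurations, so comparing
  cardinalities gives the factor \<open>1/4\<close>.\<close>

lemma prob_two_bits:
  assumes E: "depends_on E (lo + 1) (hi - 1)" and y: "lo \<le> y" "y + 1 \<le> hi"
  shows "measure_pmf.prob (fair lo hi) {g. g y = u \<and> g (y + 1) = v \<and> E (xor3 g)}
    \<le> measure_pmf.prob (fair (lo + 1) (hi - 1)) {g. E g} / 4"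
proof -
  let ?A = "{g \<in> windows lo hi. g y = u \<and> g (y + 1) = v \<and> E (xor3 g)}"
  let ?B = "{g \<in> windows (lo + 1) (hi - 1). E g}"
  let ?\<phi> = "\<lambda>g. cut (lo + 1) (hi - 1) (xor3 g)"
  have "card ?A \<le> card ?B"
  proof (rule card_inj_on_le)
    show "inj_on ?\<phi> ?A"
    proof (rule inj_onI)
      fix g h assume g: "g \<in> ?A" and h: "h \<in> ?A" and eq: "?\<phi> g = ?\<phi> h"
      have X: "xor3 g x = xor3 h x" if "lo < x" "x < hi" for x
        using fun_cong[OF eq, of x] that by (simp add: cut_def)
      show "g = h"
      proof
        fix x show "g x = h x"
        proof (cases "lo \<le> x \<and> x \<le> hi")
          case True
          then show ?thesis using xor3_determines[of lo hi g h y x] X y g h by auto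
        next
          case False
          then show ?thesis using g h by (auto simp: windows_def)
        qed
      qed
    qed
    show "?\<phi> ` ?A \<subseteq> ?B"
    proof
      fix w assume "w \<in> ?\<phi> ` ?A"
      then obtain g where g: "g \<in> ?A" "w = ?\<phi> g" by blast
      have "E (xor3 g) = E w" using E unfolding depends_on_def g(2) by (auto simp: cut_def)
      then show "w \<in> ?B" using g by auto
    qed
    show "finite ?B" by simp
  qed
  moreover have "nat (hi - lo + 1) = Suc (Suc (nat (hi - 1 - (lo + 1) + 1)))" using y by linarith
  ultimately show ?thesis by (simp add: prob_fair field_simps)
qed

text \<open>Summing over the value of an adjacent bit reduces this to two fixed bits; the neighbour
  is taken on a side that lies in the window.\<close>

lemma prob_one_bit:
  assumes E: "depends_on E (lo + 1) (hi - 1)" and y: "lo \<le> y" "y \<le> hi" "lo < hi"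
  shows "measure_pmf.prob (fair lo hi) {g. g y = u \<and> E (xor3 g)}
    \<le> measure_pmf.prob (fair (lo + 1) (hi - 1)) {g. E g} / 2"
proof -
  let ?P = "measure_pmf.prob (fair lo hi)"
  let ?q = "measure_pmf.prob (fair (lo + 1) (hi - 1)) {g. E g}"
  consider "y + 1 \<le> hi" | "lo \<le> y - 1" using y by linarith
  then show ?thesis
  proof cases
    case 1
    have "?P {g. g y = u \<and> E (xor3 g)}
      \<le> ?P ({g. g y = u \<and> g (y + 1) = True \<and> E (xor3 g)} \<union> {g. g y = u \<and> g (y + 1) = False \<and> E (xor3 g)})"
      by (rule measure_pmf.finite_measure_mono) auto
    also have "\<dots> \<le> ?q / 4 + ?q / 4"
      by (intro order_trans[OF measure_Un_le] add_mono prob_two_bits E y 1) auto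
    finally show ?thesis by simp
  next
    case 2
    have "?P {g. g y = u \<and> E (xor3 g)}
      \<le> ?P ({g. g (y - 1) = True \<and> g (y - 1 + 1) = u \<and> E (xor3 g)} \<union>
            {g. g (y - 1) = False \<and> g (y - 1 + 1) = u \<and> E (xor3 g)})"
      by (rule measure_pmf.finite_measure_mono) auto
    also have "\<dots> \<le> ?q / 4 + ?q / 4"
      using 2 y by (intro order_trans[OF measure_Un_le] add_mono prob_two_bits E) auto
    finally show ?thesis by simp
  qed
qed

lemma prob_zero_run:
  assumes "lo \<le> z - int i" "z \<le> hi"
  shows "measure_pmf.prob (fair lo hi) {g. \<forall>x. z - int i \<le> x \<and> x \<le> z \<longrightarrow> \<not> g x} = (1/2) ^ Suc i"
proof -
  have "{g. \<forall>x. z - int i \<le> x \<and> x \<le> z \<longrightarrow> \<not> g x}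
      = Pi {lo..hi} (\<lambda>x. if x \<in> {z - int i..z} then {False} else UNIV)"
    using assms by (auto simp: Pi_def)
  then have "measure_pmf.prob (fair lo hi) {g. \<forall>x. z - int i \<le> x \<and> x \<le> z \<longrightarrow> \<not> g x}
      = (\<Prod>x\<in>{lo..hi}. measure_pmf.prob (pmf_of_set UNIV) (if x \<in> {z - int i..z} then {False} else UNIV))"
    by (simp add: fair_Pi_pmf measure_Pi_pmf_Pi)
  also have "\<dots> = (\<Prod>x\<in>{lo..hi}. if x \<in> {z - int i..z} then 1/2 else 1)"
    by (intro prod.cong) (auto simp: measure_pmf_of_set)
  also have "\<dots> = (\<Prod>x\<in>{lo..hi} \<inter> {z - int i..z}. 1/2)"
    by (subst prod.inter_restrict) auto
  also have "{lo..hi} \<inter> {z - int i..z} = {z - int i..z}" using assms by auto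
  also have "(\<Prod>x\<in>{z - int i..z}. 1/2 :: real) = (1/2) ^ Suc i"
    by (simp add: nat_add_distrib)
  finally show ?thesis .
qed

section \<open>Exponential decay of survival\<close>

lemma survives_zero: "survives mv n g x \<Longrightarrow> \<not> g x"
  by (cases n) auto

lemma abs_eq_1_iff_int: "\<bar>z - x\<bar> = 1 \<longleftrightarrow> z = x + 1 \<or> z = x - 1" for x z :: int
  by arith

lemma diag_survives_Suc:
  "survives diag_move (Suc n) g x \<longleftrightarrow> \<not> g x \<and>
    (survives diag_move n (xor3 g) (x + 1) \<or> survives diag_move n (xor3 g) (x - 1))"
  by (auto simp: diag_move_def abs_eq_1_iff_int)

lemma wide_survives_Suc:
  "survives wide_move (Suc n) g x \<longleftrightarrow> \<not> g x \<and> (survives wide_move n (xor3 g) x \<or>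
    \<not> (g (x + 1) \<and> xor3 g x) \<and> survives wide_move n (xor3 g) (x + 1) \<or>
    \<not> (g (x - 1) \<and> xor3 g x) \<and> survives wide_move n (xor3 g) (x - 1))"
  unfolding survives.simps wide_move_def abs_eq_1_iff_int by blast

lemma move_near: "mv = diag_move \<or> mv = wide_move \<Longrightarrow> mv g x z \<Longrightarrow> \<bar>z - x\<bar> \<le> 1"
  by (auto simp: diag_move_def wide_move_def)

lemma xor3_cong: "(\<And>y. \<bar>y - x\<bar> \<le> 1 \<Longrightarrow> g y = h y) \<Longrightarrow> xor3 g x = xor3 h x"
  by (simp add: xor3_def)

lemma move_cong:
  assumes "mv = diag_move \<or> mv = wide_move" "\<And>y. \<bar>y - x\<bar> \<le> 1 \<Longrightarrow> g y = h y"
  shows "mv g x z = mv h x z"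
  using assms xor3_cong[of x g h] by (auto simp: diag_move_def wide_move_def)

text \<open>Each move costs two cells on either side, one for the displacement of the path and one
  for the neighbourhood that \<open>xor3\<close> reads.\<close>

lemma survives_cong:
  assumes mv: "mv = diag_move \<or> mv = wide_move"
  shows "(\<And>y. \<bar>y - x\<bar> \<le> 2 * int n \<Longrightarrow> g y = h y) \<Longrightarrow> survives mv n g x = survives mv n h x"
proof (induction n arbitrary: g h x)
  case (Suc n)
  have "survives mv n (xor3 g) z = survives mv n (xor3 h) z" if "\<bar>z - x\<bar> \<le> 1" for z
    using that by (intro Suc.IH xor3_cong Suc.prems) auto
  moreover have "mv g x z = mv h x z" for z
    by (rule move_cong[OF mv]) (auto intro!: Suc.prems)
  moreover have "g x = h x" by (intro Suc.prems) auto
  ultimately show ?case using move_near[OF mv] by auto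
qed auto

lemma depends_on_survives:
  assumes "mv = diag_move \<or> mv = wide_move" "lo \<le> x - 2 * int n" "x + 2 * int n \<le> hi"
  shows "depends_on (\<lambda>g. survives mv n g x) lo hi"
  unfolding depends_on_def
proof (intro allI impI)
  fix g h :: "int \<Rightarrow> bool" assume "\<forall>y. lo \<le> y \<and> y \<le> hi \<longrightarrow> g y = h y"
  moreover have "lo \<le> y \<and> y \<le> hi" if "\<bar>y - x\<bar> \<le> 2 * int n" for y
    using assms(2,3) that by linarith
  ultimately have "g y = h y" if "\<bar>y - x\<bar> \<le> 2 * int n" for y
    using that by blast
  then show "survives mv n g x = survives mv n h x"
    by (rule survives_cong[OF assms(1)])
qed

lemma depends_on_conj:
  "depends_on E lo hi \<Longrightarrow> depends_on F lo hi \<Longrightarrow> depends_on (\<lambda>g. E g \<and> F g) lo hi"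
  unfolding depends_on_def by metis

lemma depends_on_disj:
  "depends_on E lo hi \<Longrightarrow> depends_on F lo hi \<Longrightarrow> depends_on (\<lambda>g. E g \<or> F g) lo hi"
  unfolding depends_on_def by metis

text \<open>The expected number of surviving paths is critical; the gain comes from counting the two paths that
  return to \<open>x\<close> after two steps once, which gives \<open>1/2 * (1/2 + 1/2 + 3/4) = 7/8\<close>.\<close>

lemma diag_survival_two_steps:
  assumes "lo \<le> x - 2 * int (n + 2)" "x + 2 * int (n + 2) \<le> hi"
    and IH: "\<And>y. \<bar>y - x\<bar> \<le> 2 \<Longrightarrow>
      measure_pmf.prob (fair (lo + 1 + 1) (hi - 1 - 1)) {g. survives diag_move n g y} \<le> p"
  shows "measure_pmf.prob (fair lo hi) {g. survives diag_move (Suc (Suc n)) g x} \<le> 7/8 * p"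
proof -
  let ?P = "measure_pmf.prob (fair (lo + 1) (hi - 1))"
  let ?A = "survives diag_move n"
  let ?E = "\<lambda>h. survives diag_move (Suc n) h (x + 1) \<or> survives diag_move (Suc n) h (x - 1)"
  have dep: "depends_on (\<lambda>g. ?A g y) (lo + 1 + 1) (hi - 1 - 1)" if "\<bar>y - x\<bar> \<le> 2" for y
    using that assms by (intro depends_on_survives) auto
  have "measure_pmf.prob (fair lo hi) {g. survives diag_move (Suc (Suc n)) g x}
    \<le> measure_pmf.prob (fair lo hi) {g. g x = False \<and> ?E (xor3 g)}"
  proof (rule measure_pmf.finite_measure_mono)
    have "?E (xor3 g)" if "survives diag_move (Suc (Suc n)) g x" for g
      using that unfolding diag_survives_Suc[of "Suc n" g] by blast
    then show "{g. survives diag_move (Suc (Suc n)) g x} \<subseteq> {g. g x = False \<and> ?E (xor3 g)}"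
      using survives_zero by blast
  qed simp
  also have "\<dots> \<le> ?P {h. ?E h} / 2"
    using assms by (intro prob_one_bit depends_on_disj depends_on_survives) auto
  also have "?P {h. ?E h} \<le> ?P ({h. h (x + 1) = False \<and> ?A (xor3 h) (x + 2)} \<union>
      {h. h (x - 1) = False \<and> ?A (xor3 h) (x - 2)} \<union>
      {h. h (x + 1) = False \<and> ?A (xor3 h) x} \<union>
      {h. h x = True \<and> h (x + 1) = True \<and> ?A (xor3 h) x})"
  proof (rule measure_pmf.finite_measure_mono)
    have "h (x + 1) = False \<and> ?A (xor3 h) (x + 2) \<or> h (x - 1) = False \<and> ?A (xor3 h) (x - 2) \<or>
        h (x + 1) = False \<and> ?A (xor3 h) x \<or> h x = True \<and> h (x + 1) = True \<and> ?A (xor3 h) x"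
      if "?E h" for h
      using that
    proof
      assume "survives diag_move (Suc n) h (x + 1)"
      moreover have "x + 1 + 1 = x + 2" "x + 1 - 1 = x" by auto
      ultimately show ?thesis unfolding diag_survives_Suc by auto
    next
      assume *: "survives diag_move (Suc n) h (x - 1)"
      have "x - 1 + 1 = x" "x - 1 - 1 = x - 2" by auto
      then have **: "\<not> h (x - 1)" "?A (xor3 h) x \<or> ?A (xor3 h) (x - 2)"
        using * unfolding diag_survives_Suc by auto
      \<comment> \<open>Survival at \<open>x\<close> needs \<open>xor3 h x\<close> to be 0, so with
        \<open>h (x - 1)\<close> equal to 0 the bits at \<open>x\<close> and \<open>x + 1\<close>
        agree. If both are 0, the event is already covered by the path through \<open>x + 1\<close>;
        only two fixed 1s, of cost \<open>1/4\<close>, are new.\<close>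
      moreover have "h x \<or> \<not> h (x + 1)" if "?A (xor3 h) x"
        using survives_zero[OF that] \<open>\<not> h (x - 1)\<close> by (auto simp: xor3_def)
      ultimately show ?thesis by blast
    qed
    then show "{h. ?E h} \<subseteq> {h. h (x + 1) = False \<and> ?A (xor3 h) (x + 2)} \<union>
      {h. h (x - 1) = False \<and> ?A (xor3 h) (x - 2)} \<union>
      {h. h (x + 1) = False \<and> ?A (xor3 h) x} \<union>
      {h. h x = True \<and> h (x + 1) = True \<and> ?A (xor3 h) x}" by blast
  qed simp
  also have "\<dots> \<le> p / 2 + p / 2 + p / 2 + p / 4"
  proof (intro order_trans[OF measure_Un_le] add_mono)
    have half: "?P {h. h y = False \<and> ?A (xor3 h) z} \<le> p / 2" if "\<bar>y - x\<bar> \<le> 1" "\<bar>z - x\<bar> \<le> 2" for y z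
      using that assms(1,2) by (intro order_trans[OF prob_one_bit[OF dep]] divide_right_mono IH) auto
    show "?P {h. h (x + 1) = False \<and> ?A (xor3 h) (x + 2)} \<le> p / 2"
      "?P {h. h (x - 1) = False \<and> ?A (xor3 h) (x - 2)} \<le> p / 2"
      "?P {h. h (x + 1) = False \<and> ?A (xor3 h) x} \<le> p / 2"
      by (auto intro!: half[simplified])
    show "?P {h. h x = True \<and> h (x + 1) = True \<and> ?A (xor3 h) x} \<le> p / 4"
      using assms(1,2) by (intro order_trans[OF prob_two_bits[OF dep]] divide_right_mono IH) auto
  qed auto
  finally show ?thesis by simp
qed

text \<open>\<open>7/8 = 224/256\<close> is just below \<open>(15/16)^2 = 225/256\<close>, which
  turns the gain over two steps into a rate per step.\<close>

lemma prob_diag_survival: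
  assumes "lo \<le> x - 2 * int n" "x + 2 * int n \<le> hi"
  shows "measure_pmf.prob (fair lo hi) {g. survives diag_move n g x} \<le> (15/16) ^ n"
  using assms
proof (induction n arbitrary: lo hi x rule: induct_nat_012)
  case 0
  then show ?case by simp
next
  case 1
  have "measure_pmf.prob (fair lo hi) {g. survives diag_move (Suc 0) g x}
    \<le> measure_pmf.prob (fair lo hi) {g. \<forall>y. x - int 0 \<le> y \<and> y \<le> x \<longrightarrow> \<not> g y}"
    by (rule measure_pmf.finite_measure_mono) auto
  also have "\<dots> = (1/2) ^ Suc 0" using 1 by (intro prob_zero_run) auto
  finally show ?case by simp
next
  case (ge2 n)
  have "measure_pmf.prob (fair lo hi) {g. survives diag_move (Suc (Suc n)) g x} \<le> 7/8 * (15/16) ^ n"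
    using ge2.prems by (intro diag_survival_two_steps ge2.IH) auto
  also have "\<dots> \<le> (15/16)^2 * (15/16) ^ n"
    by (intro mult_right_mono) (auto simp: power2_eq_square)
  finally show ?case by (simp add: power2_eq_square)
qed

section \<open>Wide paths and runs of 0s\<close>

text \<open>With 0s at \<open>x\<close> and \<open>x + 1\<close>, \<open>xor3 g x\<close> equals
  \<open>g (x - 1)\<close>. An unblocked move from \<open>x\<close> to a surviving
  \<open>x - 1\<close> therefore forces \<open>xor3 g\<close> to be 0 at both \<open>x - 1\<close>
  and \<open>x\<close>, and the induction hypothesis replaces it by waiting at \<open>x\<close>. The
  other side is symmetric, so both cells have the same continuations, through \<open>x\<close> or
  \<open>x + 1\<close>.\<close>

lemma wide_survives_neighbour:
  "\<not> g x \<Longrightarrow> \<not> g (x + 1) \<Longrightarrow> survives wide_move n g x \<longleftrightarrow> survives wide_move n g (x + 1)"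
proof (induction n arbitrary: g x)
  case (Suc n)
  let ?W = "survives wide_move n (xor3 g)"
  have "?W x \<or> ?W (x + 1)" if "?W (x - 1)" "\<not> (g (x - 1) \<and> xor3 g x)"
  proof -
    have "\<not> xor3 g x" using Suc.prems that by (auto simp: xor3_def)
    then show ?thesis using Suc.IH[of "xor3 g" "x - 1"] survives_zero[OF that(1)] that by simp
  qed
  moreover have "?W x \<or> ?W (x + 1)" if "?W (x + 2)" "\<not> (g (x + 2) \<and> xor3 g (x + 1))"
  proof -
    have e: "x + 1 + 1 = x + 2" "x + 1 - 1 = x" by auto
    then have "\<not> xor3 g (x + 1)" using Suc.prems that unfolding xor3_def e by blast
    then show ?thesis using Suc.IH[of "xor3 g" "x + 1"] survives_zero[OF that(1)] that
      unfolding e by simp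
  qed
  moreover have "x + 1 + 1 = x + 2" "x + 1 - 1 = x" by auto
  ultimately show ?case using Suc.prems unfolding wide_survives_Suc by metis
qed simp

text \<open>Survival of wide paths depends only on the maximal run of 0s containing the starting point. A run
  of length at least 3 shrinks by one cell at each end, a run of length 2 dies, and a run of length 1
  becomes the run through the same cell at the next time, so runs do not branch.\<close>

definition run_survives :: "nat \<Rightarrow> nat \<Rightarrow> (int \<Rightarrow> bool) \<Rightarrow> int \<Rightarrow> bool" where
  "run_survives n i g z \<longleftrightarrow> survives wide_move n g z \<and>
    (\<forall>x. z - int i \<le> x \<and> x \<le> z \<longrightarrow> \<not> g x) \<and> g (z - int i - 1)"

lemma depends_on_run_survives:
  assumes "lo \<le> z - 2 * int n" "lo \<le> z - int i - 1" "z + 2 * int n \<le> hi"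
  shows "depends_on (\<lambda>g. run_survives n i g z) lo hi"
proof -
  have "depends_on (\<lambda>g. \<forall>x. z - int i \<le> x \<and> x \<le> z \<longrightarrow> \<not> g x) lo hi"
    unfolding depends_on_def
  proof (intro allI impI)
    fix g h :: "int \<Rightarrow> bool" assume "\<forall>x. lo \<le> x \<and> x \<le> hi \<longrightarrow> g x = h x"
    then have "g x = h x" if "z - int i \<le> x \<and> x \<le> z" for x
      using that assms by simp
    then show "(\<forall>x. z - int i \<le> x \<and> x \<le> z \<longrightarrow> \<not> g x) = (\<forall>x. z - int i \<le> x \<and> x \<le> z \<longrightarrow> \<not> h x)"
      by blast
  qed
  moreover have "depends_on (\<lambda>g. g (z - int i - 1)) lo hi"
    unfolding depends_on_def using assms by simp
  ultimately show ?thesis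
    unfolding run_survives_def using assms by (intro depends_on_conj depends_on_survives) auto
qed

text \<open>Here \<open>z\<close> is the left end of its run. If \<open>z + 1\<close> is 0 too, then
  \<open>z\<close> turns into 1 and the path has to move to \<open>z + 1\<close>, the next left end.
  If \<open>z + 1\<close> is 1, the path can wait at \<open>z\<close>, but the extent of the next
  run is unknown.\<close>

lemma run_survives_start:
  assumes "run_survives (Suc n) 0 g z"
  shows "\<not> g z \<and> \<not> g (z + 1) \<and> run_survives n 0 (xor3 g) (z + 1) \<or>
    \<not> g z \<and> g (z + 1) \<and> survives wide_move n (xor3 g) z"
proof -
  let ?W = "survives wide_move n (xor3 g)"
  have g: "\<not> g z" "g (z - 1)" using assms by (auto simp: run_survives_def)
  obtain y where y': "y = z \<or> y = z + 1 \<or> y = z - 1 \<and> \<not> xor3 g z" and y: "?W y"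
    using assms g unfolding run_survives_def wide_survives_Suc by blast
  note zero = survives_zero[OF y]
  show ?thesis
  proof (cases "g (z + 1)")
    case True
    then have X: "\<not> xor3 g z" using g by (simp add: xor3_def)
    have "?W z"
      using y' y zero X wide_survives_neighbour[of "xor3 g" z n]
        wide_survives_neighbour[of "xor3 g" "z - 1" n] by auto
    then show ?thesis using True g by simp
  next
    case False
    then have X: "xor3 g z" using g by (simp add: xor3_def)
    then have "y = z + 1" using y' zero by auto
    then show ?thesis using y zero X False g by (auto simp: run_survives_def intro: antisym)
  qed
qed

text \<open>A step to \<open>z + 1\<close> can be replaced by waiting at \<open>z\<close>: with
  \<open>z - 1\<close> and \<open>z\<close> both 0, an unblocked step to a surviving cell forces
  \<open>xor3 g\<close> to vanish at \<open>z\<close> and \<open>z + 1\<close>, where survival is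
  then equivalent.\<close>

lemma wide_survives_inside:
  assumes "survives wide_move (Suc n) g z" "\<not> g (z - 1)"
  shows "\<exists>y\<in>{z - 1, z}. survives wide_move n (xor3 g) y"
proof -
  let ?W = "survives wide_move n (xor3 g)"
  have "?W z" if "?W (z + 1)" "\<not> (g (z + 1) \<and> xor3 g z)"
  proof -
    have "\<not> g z" using assms by simp
    then have "\<not> xor3 g z" using assms(2) that by (auto simp: xor3_def)
    then show ?thesis
      using wide_survives_neighbour[of "xor3 g" z n] survives_zero[OF that(1)] that by simp
  qed
  then show ?thesis using assms unfolding wide_survives_Suc by blast
qed

text \<open>The left cell of the run turns into 1, so \<open>z\<close> becomes the next left
  end.\<close>

lemma run_survives_two:
  assumes "run_survives (Suc n) 1 g z"
  shows "\<not> g (z - 1) \<and> \<not> g z \<and> run_survives n 0 (xor3 g) z"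
proof -
  have g: "\<not> g z" "\<not> g (z - 1)" "g (z - 1 - 1)" using assms by (auto simp: run_survives_def)
  then have X: "xor3 g (z - 1)" by (simp add: xor3_def)
  have "survives wide_move n (xor3 g) z"
    using wide_survives_inside[of n g z] assms g X survives_zero[of wide_move n "xor3 g" "z - 1"]
    by (auto simp: run_survives_def)
  then show ?thesis using g X survives_zero[of wide_move n "xor3 g" z]
    by (auto simp: run_survives_def intro: antisym)
qed

text \<open>The anchor moves from \<open>z\<close> to \<open>z - 1\<close> because \<open>z\<close>
  may be the right end of the run and turn into 1, whereas \<open>z - 1\<close> is interior. The
  left end moves right by one as well, so the count of 0s to the left drops by two.\<close>

lemma run_survives_long:
  assumes "run_survives (Suc n) (Suc (Suc i)) g z"
  shows "\<not> g (z - 1) \<and> \<not> g z \<and> run_survives n i (xor3 g) (z - 1)"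
proof -
  have zero: "\<not> g x" if "z - int i - 2 \<le> x" "x \<le> z" for x
    using assms that by (auto simp: run_survives_def)
  have one: "g (z - int i - 3)" using assms by (simp add: run_survives_def algebra_simps)
  have X0: "\<not> xor3 g x" if "z - int i - 1 \<le> x" "x \<le> z - 1" for x
    using zero[of "x - 1"] zero[of x] zero[of "x + 1"] that by (simp add: xor3_def)
  have X1: "xor3 g (z - 1 - int i - 1)"
    using zero[of "z - 1 - int i - 1"] zero[of "z - 1 - int i - 1 + 1"] one
    by (simp add: xor3_def algebra_simps)
  have "survives wide_move n (xor3 g) (z - 1)"
    using wide_survives_inside[of n g z] assms zero[of "z - 1"] X0[of "z - 1"]
      wide_survives_neighbour[of "xor3 g" "z - 1" n] survives_zero[of wide_move n "xor3 g" z]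
    by (auto simp: run_survives_def)
  then show ?thesis using zero[of "z - 1"] zero[of z] X0 X1 by (auto simp: run_survives_def)
qed

text \<open>Cuts the run lengths off at \<open>n\<close>: longer runs are absorbed into the second
  alternative, whose probability is \<open>(1/2) ^ Suc n\<close>.\<close>

lemma wide_survives_runs:
  assumes "survives wide_move n g z"
  shows "(\<exists>i<n. run_survives n i g z) \<or> (\<forall>x. z - int n \<le> x \<and> x \<le> z \<longrightarrow> \<not> g x)"
proof (cases "\<exists>i<n. g (z - int i - 1)")
  case True
  define i where "i = (LEAST i. g (z - int i - 1))"
  obtain j where j: "j < n" "g (z - int j - 1)" using True by blast
  have i: "g (z - int i - 1)" "i < n"
    unfolding i_def using LeastI[of "\<lambda>i. g (z - int i - 1)", OF j(2)]
      Least_le[of "\<lambda>i. g (z - int i - 1)", OF j(2)] j by auto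
  have "\<not> g x" if "z - int i \<le> x" "x \<le> z" for x
  proof (cases "x = z")
    case True
    then show ?thesis using survives_zero[OF assms] by simp
  next
    case False
    then have "nat (z - x - 1) < i" "z - int (nat (z - x - 1)) - 1 = x" using that by auto
    then show ?thesis using not_less_Least[of "nat (z - x - 1)" "\<lambda>i. g (z - int i - 1)"]
      by (simp add: i_def)
  qed
  then show ?thesis using i assms by (auto simp: run_survives_def)
next
  case False
  have "\<not> g x" if "z - int n \<le> x" "x \<le> z" for x
  proof (cases "x = z")
    case True
    then show ?thesis using survives_zero[OF assms] by simp
  next
    case F: False
    then have "nat (z - x - 1) < n" "z - int (nat (z - x - 1)) - 1 = x" using that by auto
    then show ?thesis using False by metis
  qed
  then show ?thesis by blast
qed

text \<open>The bound on runs is a hypothesis because the induction that proves it uses this lemma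
  for the previous number of steps.\<close>

lemma prob_wide_survival_aux:
  assumes L: "\<And>i. i < n \<Longrightarrow> measure_pmf.prob (fair lo hi) {g. run_survives n i g z} \<le> (7/8) ^ n * (3/5) ^ i"
    and win: "lo \<le> z - int n" "z \<le> hi"
  shows "measure_pmf.prob (fair lo hi) {g. survives wide_move n g z} \<le> 5/2 * (7/8) ^ n"
proof -
  let ?P = "measure_pmf.prob (fair lo hi)"
  have "?P {g. survives wide_move n g z} \<le> ?P ((\<Union>i<n. {g. run_survives n i g z}) \<union>
      {g. \<forall>x. z - int n \<le> x \<and> x \<le> z \<longrightarrow> \<not> g x})"
    by (rule measure_pmf.finite_measure_mono) (use wide_survives_runs in auto)
  also have "\<dots> \<le> ?P (\<Union>i<n. {g. run_survives n i g z}) +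
      ?P {g. \<forall>x. z - int n \<le> x \<and> x \<le> z \<longrightarrow> \<not> g x}"
    by (rule measure_Un_le) auto
  also have "?P {g. \<forall>x. z - int n \<le> x \<and> x \<le> z \<longrightarrow> \<not> g x} = (1/2) ^ Suc n"
    by (rule prob_zero_run[OF win])
  also have "?P (\<Union>i<n. {g. run_survives n i g z}) \<le> (\<Sum>i<n. ?P {g. run_survives n i g z})"
    by (rule measure_UNION_le) auto
  also have "\<dots> \<le> (\<Sum>i<n. (7/8) ^ n * (3/5) ^ i)"
    by (intro sum_mono L) auto
  also have "\<dots> = (7/8) ^ n * (5/2 * (1 - (3/5) ^ n))"
    by (simp add: sum_distrib_left[symmetric] sum_gp_strict)
  finally have "?P {g. survives wide_move n g z}
      \<le> 5/2 * (7/8) ^ n - 5/2 * ((7/8) ^ n * (3/5) ^ n) + (1/2) ^ Suc n"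
    by (simp add: algebra_simps)
  \<comment> \<open>The truncation of the geometric series leaves room for the long runs because
    \<open>1/2 \<le> 7/8 * (3/5) = 21/40\<close>.\<close>
  moreover have "(1/2 :: real) ^ n \<le> (7/8 * (3/5)) ^ n" by (intro power_mono) auto
  then have "(1/2 :: real) ^ n \<le> (7/8) ^ n * (3/5) ^ n" by (simp only: power_mult_distrib)
  moreover have "0 \<le> (1/2 :: real) ^ n" by simp
  ultimately show ?thesis unfolding power_Suc by linarith
qed

text \<open>With \<open>\<rho> = 7/8\<close> and \<open>\<beta> = 3/5\<close>, the induction needs \<open>(1 + 1 / (1 - \<beta>)) / 4 \<le> \<rho>\<close>, \<open>1/4 \<le> \<rho> * \<beta>\<close> and
  \<open>1/4 \<le> \<rho> * \<beta>\<^sup>2\<close>.\<close>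

lemma prob_run_survival:
  assumes "lo \<le> z - 2 * int n" "lo \<le> z - int i - 1" "z + 2 * int n \<le> hi"
  shows "measure_pmf.prob (fair lo hi) {g. run_survives n i g z} \<le> (7/8) ^ n * (3/5) ^ i"
  using assms
proof (induction n arbitrary: lo hi z i)
  case 0
  have "measure_pmf.prob (fair lo hi) {g. run_survives 0 i g z}
      \<le> measure_pmf.prob (fair lo hi) {g. \<forall>x. z - int i \<le> x \<and> x \<le> z \<longrightarrow> \<not> g x}"
    by (rule measure_pmf.finite_measure_mono) (auto simp: run_survives_def)
  also have "\<dots> = (1/2) ^ Suc i" using 0 by (intro prob_zero_run) auto
  also have "\<dots> \<le> (1/2) ^ i" by simp
  also have "\<dots> \<le> (3/5) ^ i" by (intro power_mono) auto
  finally show ?case by simp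
next
  case (Suc n)
  let ?P = "measure_pmf.prob (fair lo hi)"
  let ?P' = "measure_pmf.prob (fair (lo + 1) (hi - 1))"
  have L: "?P {g. g y = u \<and> g (y + 1) = v \<and> run_survives n j (xor3 g) w} \<le> (7/8) ^ n * (3/5) ^ j / 4"
    if "lo \<le> y" "y + 1 \<le> hi" "lo + 1 \<le> w - 2 * int n" "lo + 1 \<le> w - int j - 1"
      "w + 2 * int n \<le> hi - 1" for y u v j w
    using that
    by (intro order_trans[OF prob_two_bits[OF depends_on_run_survives]] divide_right_mono Suc.IH) auto
  consider "i = 0" | "i = 1" | j where "i = Suc (Suc j)"
    by (metis One_nat_def not0_implies_Suc)
  then show ?case
  proof cases
    case 1
    \<comment> \<open>A single-cell run passes to a run of unknown extent, so the induction
      hypothesis is summed over run lengths here; this yields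
      \<open>5/2 = 1 / (1 - 3/5)\<close>.\<close>
    have "?P' {g. survives wide_move n g z} \<le> 5/2 * (7/8) ^ n"
      using Suc.prems by (intro prob_wide_survival_aux Suc.IH) auto
    then have W: "?P {g. g z = False \<and> g (z + 1) = True \<and> survives wide_move n (xor3 g) z}
        \<le> 5/2 * (7/8) ^ n / 4"
      using Suc.prems
      by (intro order_trans[OF prob_two_bits[OF depends_on_survives]] divide_right_mono) auto
    have "?P {g. run_survives (Suc n) i g z} \<le>
        ?P ({g. g z = False \<and> g (z + 1) = False \<and> run_survives n 0 (xor3 g) (z + 1)} \<union>
            {g. g z = False \<and> g (z + 1) = True \<and> survives wide_move n (xor3 g) z})"
      by (rule measure_pmf.finite_measure_mono) (use run_survives_start 1 in auto)
    also have "\<dots> \<le> (7/8) ^ n * (3/5) ^ 0 / 4 + 5/2 * (7/8) ^ n / 4"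
      using Suc.prems by (intro order_trans[OF measure_Un_le] add_mono L W) auto
    finally show ?thesis using 1 by simp
  next
    case 2
    have "?P {g. run_survives (Suc n) i g z} \<le>
        ?P {g. g (z - 1) = False \<and> g (z - 1 + 1) = False \<and> run_survives n 0 (xor3 g) z}"
      by (rule measure_pmf.finite_measure_mono) (use run_survives_two 2 in auto)
    also have "\<dots> \<le> (7/8) ^ n * (3/5) ^ 0 / 4"
      using Suc.prems 2 by (intro L) auto
    also have "\<dots> \<le> 7/8 * (3/5) * (7/8) ^ n"
    proof -
      have "0 \<le> (7/8 :: real) ^ n" by (rule zero_le_power) simp
      then show ?thesis unfolding power_0 by linarith
    qed
    also have "\<dots> = (7/8) ^ Suc n * (3/5) ^ i" using 2 by simp
    finally show ?thesis .
  next
    case 3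
    have "?P {g. run_survives (Suc n) i g z} \<le>
        ?P {g. g (z - 1) = False \<and> g (z - 1 + 1) = False \<and> run_survives n j (xor3 g) (z - 1)}"
      unfolding 3 by (rule measure_pmf.finite_measure_mono) (simp_all add: Collect_mono run_survives_long)
    also have "\<dots> \<le> (7/8) ^ n * (3/5) ^ j / 4"
      using Suc.prems 3 by (intro L) auto
    also have "\<dots> \<le> 7/8 * (9/25) * ((7/8) ^ n * (3/5) ^ j)"
    proof -
      have "0 \<le> (7/8 :: real) ^ n * (3/5) ^ j" by (intro mult_nonneg_nonneg zero_le_power) auto
      then show ?thesis by linarith
    qed
    also have "\<dots> = (7/8) ^ Suc n * (3/5) ^ i" unfolding 3 power_Suc by linarith
    finally show ?thesis .
  qed
qed

lemma prob_survival:
  assumes mv: "mv = diag_move \<or> mv = wide_move" and win: "lo \<le> x - 2 * int n" "x + 2 * int n \<le> hi"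
  shows "measure_pmf.prob (fair lo hi) {g. survives mv n g x} \<le> 3 * (15/16) ^ n"
  using mv
proof
  assume "mv = diag_move"
  moreover have "(15/16 :: real) ^ n \<le> 3 * (15/16) ^ n" by simp
  ultimately show ?thesis using order_trans[OF prob_diag_survival[OF win]] by blast
next
  assume "mv = wide_move"
  moreover have "measure_pmf.prob (fair lo hi) {g. survives wide_move n g x} \<le> 5/2 * (7/8) ^ n"
    using win by (intro prob_wide_survival_aux prob_run_survival) auto
  moreover have "(7/8 :: real) ^ n \<le> (15/16) ^ n" by (intro power_mono) auto
  then have "5/2 * (7/8 :: real) ^ n \<le> 3 * (15/16) ^ n" by (intro mult_mono) auto
  ultimately show ?thesis using order_trans by blast
qed

section \<open>The edges of the light cone\<close>

lemma xor3_pow_left_zero: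
  assumes "\<And>x. x < a \<Longrightarrow> \<not> g x"
  shows "x < a - int t \<Longrightarrow> \<not> (xor3 ^^ t) g x"
proof (induction t arbitrary: x)
  case (Suc t)
  then show ?case by (simp add: xor3_def)
qed (use assms in auto)

text \<open>Cell \<open>x\<close> is the rightmost one read by \<open>xor3\<close> at
  \<open>x - 1\<close>, so it can be solved for once the cells to its left are known: in the frame
  of the edge the rule is triangular.\<close>

lemma xor3_determines_from_left:
  assumes "\<And>x. x < a \<Longrightarrow> g x = h x" "\<And>x. x < b \<Longrightarrow> xor3 g x = xor3 h x"
  shows "x \<le> b \<Longrightarrow> g x = h x"
proof (induction "nat (x - a)" arbitrary: x rule: less_induct)
  case less
  show ?case
  proof (cases "x < a")
    case False
    have "g (x - 1 - 1) = h (x - 1 - 1)" "g (x - 1) = h (x - 1)"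
      using less False assms(1) by (cases "x - 1 < a"; cases "x - 1 - 1 < a"; simp)+
    moreover have "xor3 g (x - 1) = xor3 h (x - 1)" using less.prems assms(2) by simp
    moreover have "x - 1 + 1 = x" by simp
    ultimately show ?thesis unfolding xor3_def by metis
  qed (use assms in auto)
qed

lemma xor3_pow_determines_from_left:
  assumes "\<And>x. x < a \<Longrightarrow> \<not> g x" "\<And>x. x < a \<Longrightarrow> \<not> h x"
  shows "(\<And>x. x \<le> b - int t \<Longrightarrow> (xor3 ^^ t) g x = (xor3 ^^ t) h x) \<Longrightarrow> x \<le> b \<Longrightarrow> g x = h x"
proof (induction t)
  case (Suc t)
  have "(xor3 ^^ t) g y = (xor3 ^^ t) h y" if "y \<le> b - int t" for y
  proof (rule xor3_determines_from_left[where a = "a - int t" and b = "b - int t"])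
    show "(xor3 ^^ t) g x = (xor3 ^^ t) h x" if "x < a - int t" for x
      using that xor3_pow_left_zero[of a g x t] xor3_pow_left_zero[of a h x t] assms by auto
    show "xor3 ((xor3 ^^ t) g) x = xor3 ((xor3 ^^ t) h) x" if "x < b - int t" for x
      using Suc.prems(1)[of x] that by simp
  qed (use that in auto)
  then show ?case using Suc by blast
qed auto

lemma prob_fair_transfer:
  assumes inj: "inj_on \<phi> (windows a b)" and img: "\<And>g. \<phi> g \<in> windows c d"
    and EF: "\<And>g. F g \<Longrightarrow> E (\<phi> g)" and len: "d - c = b - a"
  shows "measure_pmf.prob (fair a b) {g. F g} \<le> measure_pmf.prob (fair c d) {g. E g}"
proof -
  have "card {g \<in> windows a b. F g} \<le> card {g \<in> windows c d. E g}"
    using img EF by (intro card_inj_on_le[of \<phi>] inj_on_subset[OF inj]) auto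
  then show ?thesis using len by (simp add: prob_fair divide_right_mono)
qed

text \<open>Triangularity makes the state at time \<open>t\<close>, truncated to the shifted window,
  an injective function of the seed. Both windows have the same length, so the uniform law is
  preserved.\<close>

lemma prob_left_edge_window:
  assumes "depends_on E (a - int t) (b - int t)"
  shows "measure_pmf.prob (fair a b) {g. E ((xor3 ^^ t) g)}
    \<le> measure_pmf.prob (fair (a - int t) (b - int t)) {g. E g}"
proof (rule prob_fair_transfer[where \<phi> = "\<lambda>g. cut (a - int t) (b - int t) ((xor3 ^^ t) g)"])
  show "inj_on (\<lambda>g. cut (a - int t) (b - int t) ((xor3 ^^ t) g)) (windows a b)"
  proof (rule inj_onI)
    fix g h assume g: "g \<in> windows a b" and h: "h \<in> windows a b"
      and eq: "cut (a - int t) (b - int t) ((xor3 ^^ t) g) = cut (a - int t) (b - int t) ((xor3 ^^ t) h)"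
    have zero: "\<not> g x" "\<not> h x" if "x < a" for x using g h that by (auto simp: windows_def)
    have X: "(xor3 ^^ t) g x = (xor3 ^^ t) h x" if "x \<le> b - int t" for x
    proof (cases "x < a - int t")
      case True
      then show ?thesis
        using xor3_pow_left_zero[of a g x t] xor3_pow_left_zero[of a h x t] zero by auto
    next
      case False
      then show ?thesis using fun_cong[OF eq, of x] that by (simp add: cut_def)
    qed
    show "g = h"
    proof
      fix x show "g x = h x"
      proof (cases "x \<le> b")
        case True
        then show ?thesis using xor3_pow_determines_from_left[of a g h b t x] zero X by blast
      next
        case False
        then show ?thesis using g h by (auto simp: windows_def)
      qed
    qed
  qed
  show "E (cut (a - int t) (b - int t) ((xor3 ^^ t) g))" if "E ((xor3 ^^ t) g)" for g
  proof -
    have "E ((xor3 ^^ t) g) = E (cut (a - int t) (b - int t) ((xor3 ^^ t) g))"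
      using assms unfolding depends_on_def by (auto simp: cut_def)
    then show ?thesis using that by blast
  qed
qed auto

text \<open>A sign \<open>s\<close> treats translations and reflections together: the former serve
  the periodicity in time, the latter carry the left edge to the right one.\<close>

lemma xor3_isometry:
  assumes "s = 1 \<or> s = -1"
  shows "xor3 (\<lambda>y. g (c + s * y)) = (\<lambda>y. xor3 g (c + s * y))"
  using assms
proof
  assume s: "s = 1"
  show ?thesis unfolding s xor3_def by (rule ext) (simp add: algebra_simps)
next
  assume s: "s = -1"
  show ?thesis unfolding s xor3_def by (rule ext) (auto simp: algebra_simps)
qed

lemma xor3_pow_isometry:
  assumes "s = 1 \<or> s = -1"
  shows "(xor3 ^^ t) (\<lambda>y. g (c + s * y)) = (\<lambda>y. (xor3 ^^ t) g (c + s * y))"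
  by (induction t) (use xor3_isometry[OF assms] in auto)

lemma survives_isometry:
  assumes mv: "mv = diag_move \<or> mv = wide_move" and s: "s = 1 \<or> s = -1"
  shows "survives mv n (\<lambda>y. g (c + s * y)) x = survives mv n g (c + s * x)"
proof (induction n arbitrary: g x)
  case (Suc n)
  have mv': "mv (\<lambda>y. g (c + s * y)) x z = mv g (c + s * x) (c + s * z)" for z
    using mv s fun_cong[OF xor3_isometry[OF s, of g c], of x]
    by (auto simp: diag_move_def wide_move_def abs_minus_commute)
  have "(\<exists>z. mv g (c + s * x) (c + s * z) \<and> survives mv n (xor3 g) (c + s * z)) \<longleftrightarrow>
      (\<exists>z. mv g (c + s * x) z \<and> survives mv n (xor3 g) z)"
  proof -
    have "c + s * (s * (z - c)) = z" for z using s by auto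
    then show ?thesis by metis
  qed
  then show ?case
    unfolding survives.simps mv' xor3_isometry[OF s] Suc.IH by blast
qed simp

section \<open>Periodicity in time along the edge\<close>

text \<open>Over the field with two elements this is
  \<open>(X^(-1) + 1 + X)^(2^m) = X^(-2^m) + 1 + X^(2^m)\<close>. Squaring kills the mixed terms
  because they occur twice.\<close>

lemma xor3_pow_two_power:
  "(xor3 ^^ (2 ^ m)) g x \<longleftrightarrow> (g (x - 2 ^ m) \<noteq> (g x \<noteq> g (x + 2 ^ m)))"
proof (induction m arbitrary: g x)
  case (Suc m)
  have e: "x + 2 ^ m + 2 ^ m = x + 2 ^ Suc m" "x - 2 ^ m - 2 ^ m = x - 2 ^ Suc m"
      "x + 2 ^ m - 2 ^ m = x" "x - 2 ^ m + 2 ^ m = x" for x :: int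
    by auto
  have "(xor3 ^^ (2 ^ Suc m)) g = (xor3 ^^ (2 ^ m)) ((xor3 ^^ (2 ^ m)) g)"
    by (simp add: mult_2 funpow_add)
  then show ?case unfolding Suc.IH e by (simp only:) blast
qed (simp add: xor3_def)

text \<open>Of the three cells combined by \<open>2 ^ m\<close> steps, two lie left of the light
  cone of the seed and vanish; the third is \<open>y\<close>.\<close>

lemma xor3_left_edge_periodic:
  assumes zero: "\<And>x. x < 0 \<Longrightarrow> \<not> g x" and y: "y < 2 ^ m - int t"
  shows "(xor3 ^^ (t + 2 ^ m)) g (y - 2 ^ m) = (xor3 ^^ t) g y"
proof -
  have "(xor3 ^^ (t + 2 ^ m)) g = (xor3 ^^ (2 ^ m)) ((xor3 ^^ t) g)"
    by (metis add.commute comp_apply funpow_add)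
  moreover have "y - 2 ^ m < 0 - int t" "y - 2 ^ m - 2 ^ m < 0 - int t"
    using y zero_less_power[of "2 :: int" m] by linarith+
  then have "\<not> (xor3 ^^ t) g (y - 2 ^ m)" "\<not> (xor3 ^^ t) g (y - 2 ^ m - 2 ^ m)"
    using xor3_pow_left_zero[of 0 g "y - 2 ^ m" t] xor3_pow_left_zero[of 0 g "y - 2 ^ m - 2 ^ m" t]
      zero by blast+
  ultimately show ?thesis by (simp add: xor3_pow_two_power)
qed

text \<open>\<open>k\<close> is a column in the frame of the left edge. Survival for
  \<open>n\<close> steps depends on no column beyond \<open>k + 2 * n\<close>, so all of them lie in
  the periodic range.\<close>

lemma survives_left_edge_periodic:
  assumes mv: "mv = diag_move \<or> mv = wide_move" and zero: "\<And>x. x < 0 \<Longrightarrow> \<not> g x"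
    and k: "k + 2 * int n < 2 ^ m"
  shows "survives mv n ((xor3 ^^ (t + 2 ^ m)) g) (k - int (t + 2 ^ m)) =
    survives mv n ((xor3 ^^ t) g) (k - int t)"
proof -
  have "survives mv n ((xor3 ^^ (t + 2 ^ m)) g) (k - int (t + 2 ^ m)) =
      survives mv n (\<lambda>y. (xor3 ^^ (t + 2 ^ m)) g (- (2 ^ m) + 1 * y)) (k - int t)"
    by (subst survives_isometry[OF mv]) (auto simp: algebra_simps)
  also have "\<dots> = survives mv n ((xor3 ^^ t) g) (k - int t)"
  proof (rule survives_cong[OF mv])
    fix y assume "\<bar>y - (k - int t)\<bar> \<le> 2 * int n"
    then have "y < 2 ^ m - int t" using k by linarith
    then show "(xor3 ^^ (t + 2 ^ m)) g (- (2 ^ m) + 1 * y) = (xor3 ^^ t) g y"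
      using xor3_left_edge_periodic[of g y m t, OF zero] by simp
  qed
  finally show ?thesis .
qed

lemma survives_left_edge_early:
  assumes mv: "mv = diag_move \<or> mv = wide_move" and zero: "\<And>x. x < 0 \<Longrightarrow> \<not> g x"
    and k: "k + 2 * int n < 2 ^ m"
  shows "survives mv n ((xor3 ^^ t) g) (k - int t) \<Longrightarrow>
    \<exists>t' < 2 ^ m. survives mv n ((xor3 ^^ t') g) (k - int t')"
proof (induction t rule: less_induct)
  case (less t)
  show ?case
  proof (cases "t < 2 ^ m")
    case False
    then have "t = t - 2 ^ m + 2 ^ m" by simp
    then have "survives mv n ((xor3 ^^ (t - 2 ^ m)) g) (k - int (t - 2 ^ m))"
      using less.prems survives_left_edge_periodic[where mv = mv and g = g and t = "t - 2 ^ m", OF mv zero k]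
      by simp
    moreover have "(0::nat) < 2 ^ m" by simp
    then have "t - 2 ^ m < t" using False by linarith
    ultimately show ?thesis using less.IH[of "t - 2 ^ m"] by blast
  qed (use less in blast)
qed

lemma set_pmf_fair [simp]: "set_pmf (fair a b) = windows a b"
  by (simp add: fair_def)

text \<open>Periodicity leaves only \<open>2 ^ m\<close> times for the union bound. The bounds
  \<open>2 * n \<le> k\<close> and \<open>k + 2 * n \<le> L\<close> keep the cells on which survival
  depends inside the window where the configuration is uniform.\<close>

lemma prob_left_edge_survival:
  assumes mv: "mv = diag_move \<or> mv = wide_move"
    and k: "2 * int n \<le> k" "k + 2 * int n < 2 ^ m" "k + 2 * int n \<le> L"
  shows "measure_pmf.prob (fair 0 L) {g. \<exists>t. survives mv n ((xor3 ^^ t) g) (k - int t)}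
    \<le> 2 ^ m * (3 * (15/16) ^ n)"
proof -
  let ?P = "measure_pmf.prob (fair 0 L)"
  let ?S = "\<lambda>t. {g. survives mv n ((xor3 ^^ t) g) (k - int t)}"
  \<comment> \<open>Restricting to the support supplies the vanishing left of 0 on which periodicity
    rests.\<close>
  have "?P {g. \<exists>t. survives mv n ((xor3 ^^ t) g) (k - int t)} =
      ?P ({g. \<exists>t. survives mv n ((xor3 ^^ t) g) (k - int t)} \<inter> windows 0 L)"
    by (rule measure_Int_set_pmf[of "fair 0 L", unfolded set_pmf_fair, symmetric])
  also have "\<dots> \<le> ?P (\<Union>t<2 ^ m. ?S t)"
  proof (rule measure_pmf.finite_measure_mono, rule subsetI)
    fix g assume g: "g \<in> {g. \<exists>t. survives mv n ((xor3 ^^ t) g) (k - int t)} \<inter> windows 0 L"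
    then obtain t where t: "survives mv n ((xor3 ^^ t) g) (k - int t)" by blast
    have zero: "\<not> g x" if "x < 0" for x using g that by (auto simp: windows_def)
    show "g \<in> (\<Union>t<2 ^ m. ?S t)"
      using survives_left_edge_early[OF mv zero k(2) t] by auto
  qed simp
  also have "\<dots> \<le> (\<Sum>t<2 ^ m. ?P (?S t))"
    by (rule measure_UNION_le) auto
  also have "\<dots> \<le> (\<Sum>t<(2::nat) ^ m. 3 * (15/16) ^ n)"
  proof (rule sum_mono)
    fix t :: nat
    have "?P (?S t) \<le> measure_pmf.prob (fair (0 - int t) (L - int t)) {g. survives mv n g (k - int t)}"
      using k by (intro prob_left_edge_window depends_on_survives mv) auto
    also have "\<dots> \<le> 3 * (15/16) ^ n"
      using k by (intro prob_survival mv) auto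
    finally show "?P (?S t) \<le> 3 * (15/16) ^ n" .
  qed
  finally show ?thesis by simp
qed

section \<open>Union bound over the starting points\<close>

text \<open>Two adjacent columns are enough because a path that advances by at most two per step
  cannot jump over both.\<close>

definition edge_survival :: "move \<Rightarrow> nat \<Rightarrow> (int \<Rightarrow> bool) \<Rightarrow> bool" where
  "edge_survival mv n g \<longleftrightarrow>
    (\<exists>k\<in>{2 * int n, 2 * int n + 1}. \<exists>t. survives mv n ((xor3 ^^ t) g) (k - int t))"

text \<open>The exceptional event. Its parts catch paths that start near or beyond the left end of
  the seed, near or beyond the right end, and in the bulk.\<close>

definition seed_survival :: "move \<Rightarrow> nat \<Rightarrow> int \<Rightarrow> (int \<Rightarrow> bool) \<Rightarrow> bool" where
  "seed_survival mv n L g \<longleftrightarrow> edge_survival mv n g \<or> edge_survival mv n (\<lambda>x. g (L - x)) \<or>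
    (\<exists>x\<in>{2 * int n..L - 2 * int n}. survives mv n g x)"

lemma prob_fair_reflect:
  "measure_pmf.prob (fair 0 L) {g. E (\<lambda>x. g (L - x))} \<le> measure_pmf.prob (fair 0 L) {g. E g}"
proof -
  have "card {g \<in> windows 0 L. E (\<lambda>x. g (L - x))} \<le> card {g \<in> windows 0 L. E g}"
  proof (rule card_inj_on_le[of "\<lambda>g x. g (L - x)"])
    show "inj_on (\<lambda>g x. g (L - x)) {g \<in> windows 0 L. E (\<lambda>x. g (L - x))}"
    proof (rule inj_onI, rule ext)
      fix g h :: "int \<Rightarrow> bool" and x assume eq: "(\<lambda>x. g (L - x)) = (\<lambda>x. h (L - x))"
      show "g x = h x" using fun_cong[OF eq, of "L - x"] by simp
    qed
    show "(\<lambda>g x. g (L - x)) ` {g \<in> windows 0 L. E (\<lambda>x. g (L - x))} \<subseteq> {g \<in> windows 0 L. E g}"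
    proof (rule image_subsetI)
      fix g assume g: "g \<in> {g \<in> windows 0 L. E (\<lambda>x. g (L - x))}"
      then have "0 \<le> x \<and> x \<le> L" if "g (L - x)" for x
        using that by (force simp: windows_def)
      then show "(\<lambda>x. g (L - x)) \<in> {g \<in> windows 0 L. E g}" using g by (simp add: windows_def)
    qed
  qed simp
  then show ?thesis by (simp add: prob_fair divide_right_mono)
qed

text \<open>Two edges with two columns each contribute \<open>4 * 2 ^ m\<close> starting points and
  the bulk at most \<open>L + 1\<close>. Since \<open>2 ^ m \<le> 8 * n + 2 \<le> 2 * L\<close>,
  their number is linear in \<open>L\<close>.\<close>

lemma prob_seed_survival:
  assumes mv: "mv = diag_move \<or> mv = wide_move"
    and m: "4 * int n + 1 < 2 ^ m" "2 ^ m \<le> 8 * int n + 2" and L: "4 * int n + 1 \<le> int L"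
  shows "measure_pmf.prob (fair 0 (int L)) {g. seed_survival mv n (int L) g}
    \<le> 20 * (real L + 1) * (3 * (15/16) ^ n)"
proof -
  let ?P = "measure_pmf.prob (fair 0 (int L))"
  let ?r = "3 * (15/16) ^ n :: real"
  let ?X = "{2 * int n..int L - 2 * int n}"
  have r0: "0 \<le> ?r" by simp
  have "real_of_int (2 ^ m) \<le> real_of_int (8 * int n + 2)" using m(2) by (rule of_int_le_iff[THEN iffD2])
  then have m': "2 ^ m \<le> 8 * real n + 2" by simp
  have Ln: "4 * real n + 1 \<le> real L" using L by linarith
  have "?P {g. edge_survival mv n g} \<le>
      ?P ({g. \<exists>t. survives mv n ((xor3 ^^ t) g) (2 * int n - int t)} \<union>
          {g. \<exists>t. survives mv n ((xor3 ^^ t) g) (2 * int n + 1 - int t)})"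
    by (rule measure_pmf.finite_measure_mono) (auto simp: edge_survival_def)
  also have "\<dots> \<le> 2 ^ m * ?r + 2 ^ m * ?r"
    using m L by (intro order_trans[OF measure_Un_le] add_mono prob_left_edge_survival mv) auto
  finally have edge: "?P {g. edge_survival mv n g} \<le> 2 * 2 ^ m * ?r" by simp
  have "?P (\<Union>x\<in>?X. {g. survives mv n g x}) \<le> (\<Sum>x\<in>?X. ?P {g. survives mv n g x})"
    by (rule measure_UNION_le) auto
  also have "\<dots> \<le> (\<Sum>x\<in>?X. ?r)"
    by (intro sum_mono prob_survival mv) auto
  also have "\<dots> \<le> (real L + 1) * ?r"
  proof -
    have "real (card ?X) \<le> real L + 1" by (simp add: of_nat_diff)
    then have "real (card ?X) * ?r \<le> (real L + 1) * ?r" using r0 by (rule mult_right_mono)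
    then show ?thesis by simp
  qed
  finally have bulk: "?P (\<Union>x\<in>?X. {g. survives mv n g x}) \<le> (real L + 1) * ?r" .
  have right: "?P {g. edge_survival mv n (\<lambda>x. g (int L - x))} \<le> 2 * 2 ^ m * ?r"
    using prob_fair_reflect[of "int L" "edge_survival mv n"] edge by (rule order_trans)
  have "?P {g. seed_survival mv n (int L) g} \<le> ?P ({g. edge_survival mv n g} \<union>
      {g. edge_survival mv n (\<lambda>x. g (int L - x))} \<union> (\<Union>x\<in>?X. {g. survives mv n g x}))"
    by (rule measure_pmf.finite_measure_mono) (auto simp: seed_survival_def)
  also have "\<dots> \<le> 2 * 2 ^ m * ?r + 2 * 2 ^ m * ?r + (real L + 1) * ?r"
    by (intro order_trans[OF measure_Un_le] add_mono edge bulk right) auto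
  also have "\<dots> = (4 * 2 ^ m + (real L + 1)) * ?r" by (simp only: algebra_simps)
  also have "\<dots> \<le> (20 * (real L + 1)) * ?r"
  proof (rule mult_right_mono[OF _ r0])
    show "4 * 2 ^ m + (real L + 1) \<le> 20 * (real L + 1)"
      using mult_left_mono[OF m', of 4] Ln by simp
  qed
  finally show ?thesis .
qed

section \<open>Paths that enter the cone\<close>

lemma path_survives:
  assumes "\<And>t. t < s \<Longrightarrow> mv ((xor3 ^^ t) g) (xs t) (xs (Suc t))"
    and "\<And>t. t \<le> s \<Longrightarrow> \<not> (xor3 ^^ t) g (xs t)"
  shows "t + n \<le> s \<Longrightarrow> survives mv n ((xor3 ^^ t) g) (xs t)"
proof (induction n arbitrary: t)
  case (Suc n)
  have "survives mv n ((xor3 ^^ Suc t) g) (xs (Suc t))"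
    by (rule Suc.IH) (use Suc.prems in simp)
  then show ?case using Suc.prems assms[of t] by auto
qed (use assms in auto)

lemma path_edge_survival:
  assumes path: "\<And>t. t < s \<Longrightarrow> mv ((xor3 ^^ t) g) (xs t) (xs (Suc t))"
      "\<And>t. t \<le> s \<Longrightarrow> \<not> (xor3 ^^ t) g (xs t)" "\<And>t. t < s \<Longrightarrow> \<bar>xs (Suc t) - xs t\<bar> \<le> 1"
    and "xs 0 < 2 * int n" "4 * int n + 1 \<le> xs s + int s"
  shows "edge_survival mv n g"
proof -
  \<comment> \<open>In the frame of the left edge a step advances by at most 2, so the path enters the region
    \<open>2 * n \<le> x + t\<close> in one of its first two columns and then needs \<open>n\<close> more steps.\<close>
  define P where "P t \<longleftrightarrow> 2 * int n \<le> xs t + int t" for t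
  have "\<not> P 0" "P s" using assms(4,5) by (auto simp: P_def)
  then obtain t where t: "t < s" "\<not> P t" "P (Suc t)"
    by (metis (full_types) ex_least_nat_less less_eq_Suc_le)
  have slow: "xs (Suc t + j) + int (Suc t + j) \<le> xs (Suc t) + int (Suc t) + 2 * int j"
    if "Suc t + j \<le> s" for j
    using that
  proof (induction j)
    case (Suc j)
    then show ?case using path(3)[of "Suc t + j"] by simp
  qed simp
  have k: "xs (Suc t) + int (Suc t) \<in> {2 * int n, 2 * int n + 1}"
    using t path(3)[of t] by (auto simp: P_def)
  \<comment> \<open>From a column at most \<open>2 * n + 1\<close>, fewer than \<open>n\<close>
    further steps would end at column \<open>4 * n - 1\<close> or less, short of the required
    \<open>4 * n + 1\<close>.\<close>
  have "Suc t + n \<le> s"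
  proof (rule ccontr)
    assume "\<not> Suc t + n \<le> s"
    moreover have "xs s + int s \<le> xs (Suc t) + int (Suc t) + 2 * int (s - Suc t)"
      using slow[of "s - Suc t"] t by simp
    ultimately show False using k assms(5) t by auto
  qed
  then have "survives mv n ((xor3 ^^ Suc t) g) (xs (Suc t))"
    using path_survives[of s mv g xs, OF path(1,2)] by blast
  then have "survives mv n ((xor3 ^^ Suc t) g) (xs (Suc t) + int (Suc t) - int (Suc t))"
    by simp
  then show ?thesis using k unfolding edge_survival_def by blast
qed

lemma move_reflect:
  assumes "mv = diag_move \<or> mv = wide_move"
  shows "mv (\<lambda>y. g (c - y)) (c - x) (c - z) = mv g x z"
  using assms fun_cong[OF xor3_isometry[of "-1" g c], of "c - x"]
  by (auto simp: diag_move_def wide_move_def abs_minus_commute)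

text \<open>The depth \<open>T\<close> puts the end of the path in a column at least
  \<open>4 * n + 1\<close> in the frame of either edge. A start near or beyond an end of the seed
  then forces a crossing of the strip there; any other start survives \<open>n\<close> steps from
  time 0.\<close>

lemma path_seed_survival:
  assumes mv: "mv = diag_move \<or> mv = wide_move"
    and path: "\<And>t. t < s \<Longrightarrow> mv ((xor3 ^^ t) g) (xs t) (xs (Suc t))"
      "\<And>t. t \<le> s \<Longrightarrow> \<not> (xor3 ^^ t) g (xs t)"
    and T: "4 * n + 1 \<le> T" "T \<le> s" "int T - int s \<le> xs s" "xs s \<le> L + int s - int T"
  shows "seed_survival mv n L g"
proof -
  have near: "\<bar>xs (Suc t) - xs t\<bar> \<le> 1" if "t < s" for t
    using path(1)[OF that] move_near[OF mv] by blast
  consider "xs 0 < 2 * int n" | "L - xs 0 < 2 * int n" | "xs 0 \<in> {2 * int n..L - 2 * int n}"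
    by fastforce
  then show ?thesis
  proof cases
    case 1
    then have "edge_survival mv n g"
      using T path_edge_survival[of s mv g xs n, OF path near] by linarith
    then show ?thesis unfolding seed_survival_def by blast
  next
    case 2
    have X: "(xor3 ^^ t) (\<lambda>x. g (L - x)) = (\<lambda>x. (xor3 ^^ t) g (L - x))" for t
      using xor3_pow_isometry[of "-1" t g L] by simp
    have "edge_survival mv n (\<lambda>x. g (L - x))"
    proof (rule path_edge_survival[where xs = "\<lambda>t. L - xs t" and s = s])
      show "mv ((xor3 ^^ t) (\<lambda>x. g (L - x))) (L - xs t) (L - xs (Suc t))" if "t < s" for t
        unfolding X move_reflect[OF mv] by (rule path(1)[OF that])
      show "\<not> (xor3 ^^ t) (\<lambda>x. g (L - x)) (L - xs t)" if "t \<le> s" for t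
        using path(2)[OF that] by (simp add: X)
      show "\<bar>L - xs (Suc t) - (L - xs t)\<bar> \<le> 1" if "t < s" for t
        using near[OF that] by linarith
    qed (use 2 T in auto)
    then show ?thesis unfolding seed_survival_def by blast
  next
    case 3
    have "survives mv n ((xor3 ^^ 0) g) (xs 0)"
      using T path_survives[of s mv g xs 0 n, OF path] by linarith
    then show ?thesis using 3 unfolding seed_survival_def funpow_0 by blast
  qed
qed

section \<open>Discrepancies follow empty paths\<close>

lemma evolve_eq_S1:
  assumes "web_CA f"
  shows "evolve f \<xi> t x = S1 \<longleftrightarrow> (xor3 ^^ t) (\<lambda>x. \<xi> x = S1) x"
proof (induction t arbitrary: x)
  case (Suc t)
  have "f a b c d e = S1 \<longleftrightarrow> ((b = S1) \<noteq> ((c = S1) \<noteq> (d = S1)))" for a b c d e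
  proof -
    have "\<delta> (f a b c d e) = (\<delta> b + \<delta> c + \<delta> d) mod 2"
      using assms by (simp add: web_CA_def)
    then show ?thesis by (auto simp: \<delta>_def of_bool_def split: if_splits)
  qed
  then show ?case using Suc by (simp add: ca_step_def xor3_def)
qed simp

text \<open>The interface between rules and paths: both kinds of compliance enter the later argument
  only through it.\<close>

definition discrepancies_follow :: "move \<Rightarrow> rule5 \<Rightarrow> bool" where
  "discrepancies_follow mv f \<longleftrightarrow> (\<forall>\<eta> \<eta>' z. (\<forall>x. \<eta> x = S1 \<longleftrightarrow> \<eta>' x = S1) \<longrightarrow>
    ca_step f \<eta> z \<noteq> ca_step f \<eta>' z \<longrightarrow> (\<exists>x. mv (\<lambda>x. \<eta> x = S1) x z \<and> \<eta> x \<noteq> \<eta>' x))"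

lemma diagonal_compliant_discrepancies:
  assumes f: "diagonal_compliant f"
  shows "discrepancies_follow diag_move f"
  unfolding discrepancies_follow_def
proof (intro allI impI, rule ccontr)
  fix \<eta> \<eta>' z
  assume ones: "\<forall>x. \<eta> x = S1 \<longleftrightarrow> \<eta>' x = S1" and diff: "ca_step f \<eta> z \<noteq> ca_step f \<eta>' z"
    and none: "\<not> (\<exists>x. diag_move (\<lambda>x. \<eta> x = S1) x z \<and> \<eta> x \<noteq> \<eta>' x)"
  have "\<eta> (z - 1) = \<eta>' (z - 1)" "\<eta> (z + 1) = \<eta>' (z + 1)"
    using none by (auto simp: diag_move_def)
  moreover have "\<delta> (\<eta> x) = \<delta> (\<eta>' x)" for x using ones by (simp add: \<delta>_def)
  ultimately have "ca_step f \<eta> z = ca_step f \<eta>' z"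
    using f unfolding diagonal_compliant_def ca_step_def by metis
  then show False using diff by contradiction
qed

text \<open>The arguments are exchanged one group at a time: left neighbour, right neighbour, outer
  cells. A discrepancy at a neighbour that cannot move to \<open>z\<close> is blocked by a 1 at
  \<open>z\<close> and a 1 of the next configuration at the neighbour, which is the case in which
  wide compliance ignores it. The centre agrees because waiting is never blocked.\<close>

lemma wide_compliant_discrepancies:
  assumes f: "wide_compliant f"
  shows "discrepancies_follow wide_move f"
  unfolding discrepancies_follow_def
proof (intro allI impI, rule ccontr)
  fix \<eta> \<eta>' z
  assume ones: "\<forall>x. \<eta> x = S1 \<longleftrightarrow> \<eta>' x = S1" and diff: "ca_step f \<eta> z \<noteq> ca_step f \<eta>' z"
    and none: "\<not> (\<exists>x. wide_move (\<lambda>x. \<eta> x = S1) x z \<and> \<eta> x \<noteq> \<eta>' x)"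
  note f' = f[unfolded wide_compliant_def]
  have far: "f a b c d e = f a' b c d e'" if "\<delta> a = \<delta> a'" "\<delta> e = \<delta> e'" for a b c d e a' e'
    using conjunct1[OF f'] that unfolding empty_compliant_def by blast
  have f_right: "f a b c d e = f a b c d' e"
    if "\<delta> d = \<delta> d'" "c = S1" "(\<delta> c + \<delta> d + \<delta> e) mod 2 = 1" for a b c d e d'
    by (rule conjunct1[OF conjunct2[OF f'], rule_format, OF refl that(1) refl that(2,3)])
  have f_left: "f a b c d e = f a b' c d e"
    if "\<delta> b = \<delta> b'" "c = S1" "(\<delta> a + \<delta> b + \<delta> c) mod 2 = 1" for a b c d e b'
    by (rule conjunct2[OF conjunct2[OF f'], rule_format, OF refl that(1) refl that(2,3)])
  let ?a = "\<eta> (z - 2)" and ?b = "\<eta> (z - 1)" and ?c = "\<eta> z" and ?d = "\<eta> (z + 1)" and ?e = "\<eta> (z + 2)"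
  let ?b' = "\<eta>' (z - 1)" and ?d' = "\<eta>' (z + 1)"
  have \<delta>_eq: "\<delta> (\<eta> x) = \<delta> (\<eta>' x)" for x using ones by (simp add: \<delta>_def)
  have centre: "\<eta>' z = ?c" using none by (auto simp: wide_move_def)
  have shift: "z - 1 - 1 = z - 2" "z - 1 + 1 = z" "z + 1 + 1 = z + 2" "z + 1 - 1 = z" by auto
  have left: "?c = S1 \<and> (\<delta> ?a + \<delta> ?b + \<delta> ?c) mod 2 = 1" if "?b \<noteq> ?b'"
  proof -
    have "\<not> wide_move (\<lambda>x. \<eta> x = S1) (z - 1) z"
      using none that by blast
    then have "?c = S1 \<and> xor3 (\<lambda>x. \<eta> x = S1) (z - 1)"
      by (auto simp: wide_move_def)
    then show ?thesis unfolding xor3_def shift by (auto simp: \<delta>_def)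
  qed
  have right: "?c = S1 \<and> (\<delta> ?c + \<delta> ?d + \<delta> ?e) mod 2 = 1" if "?d \<noteq> ?d'"
  proof -
    have "\<not> wide_move (\<lambda>x. \<eta> x = S1) (z + 1) z"
      using none that by blast
    then have "?c = S1 \<and> xor3 (\<lambda>x. \<eta> x = S1) (z + 1)"
      by (auto simp: wide_move_def)
    then show ?thesis unfolding xor3_def shift by (auto simp: \<delta>_def)
  qed
  have "f ?a ?b ?c ?d ?e = f ?a ?b' ?c ?d ?e"
  proof (cases "?b = ?b'")
    case False
    then show ?thesis using f_left[OF \<delta>_eq] left by blast
  qed simp
  also have "\<dots> = f ?a ?b' ?c ?d' ?e"
  proof (cases "?d = ?d'")
    case False
    then show ?thesis using f_right[OF \<delta>_eq] right by blast
  qed simp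
  also have "\<dots> = f (\<eta>' (z - 2)) ?b' ?c ?d' (\<eta>' (z + 2))"
    by (rule far[OF \<delta>_eq \<delta>_eq])
  finally show False using diff centre by (simp add: ca_step_def)
qed

text \<open>Traced backwards, each discrepancy has a predecessor one time step earlier. None of
  these cells is 1, because both evolutions have their 1s at the same places.\<close>

lemma discrepancy_path:
  assumes web: "web_CA f"
    and step: "discrepancies_follow mv f"
    and ones: "\<And>x. \<xi> x = S1 \<longleftrightarrow> \<xi>' x = S1"
  shows "evolve f \<xi> s y \<noteq> evolve f \<xi>' s y \<Longrightarrow> \<exists>xs. xs s = y \<and>
    (\<forall>t<s. mv ((xor3 ^^ t) (\<lambda>x. \<xi> x = S1)) (xs t) (xs (Suc t))) \<and>
    (\<forall>t\<le>s. \<not> (xor3 ^^ t) (\<lambda>x. \<xi> x = S1) (xs t))"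
proof (induction s arbitrary: y)
  case 0
  then have "\<xi> y \<noteq> S1" using ones[of y] by auto
  then show ?case by (intro exI[of _ "\<lambda>_. y"]) simp
next
  case (Suc s)
  let ?g = "\<lambda>x. \<xi> x = S1"
  have ones': "evolve f \<xi> t x = S1 \<longleftrightarrow> evolve f \<xi>' t x = S1" for t x
    unfolding evolve_eq_S1[OF web] ones ..
  have "ca_step f (evolve f \<xi> s) y \<noteq> ca_step f (evolve f \<xi>' s) y" using Suc.prems by simp
  moreover have "\<forall>x. evolve f \<xi> s x = S1 \<longleftrightarrow> evolve f \<xi>' s x = S1" using ones' by blast
  ultimately have "\<exists>x. mv (\<lambda>x. evolve f \<xi> s x = S1) x y \<and> evolve f \<xi> s x \<noteq> evolve f \<xi>' s x"
    using step unfolding discrepancies_follow_def by blast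
  moreover have "(\<lambda>x. evolve f \<xi> s x = S1) = (xor3 ^^ s) ?g"
    by (rule ext) (rule evolve_eq_S1[OF web])
  ultimately obtain x where x: "mv ((xor3 ^^ s) ?g) x y" "evolve f \<xi> s x \<noteq> evolve f \<xi>' s x"
    by auto
  obtain xs where xs: "xs s = x" "\<And>t. t < s \<Longrightarrow> mv ((xor3 ^^ t) ?g) (xs t) (xs (Suc t))"
      "\<And>t. t \<le> s \<Longrightarrow> \<not> (xor3 ^^ t) ?g (xs t)"
    using Suc.IH[OF x(2)] by blast
  let ?ys = "xs(Suc s := y)"
  have "\<not> (xor3 ^^ Suc s) ?g y"
    using Suc.prems ones'[of "Suc s" y] unfolding evolve_eq_S1[OF web, symmetric] by metis
  then have "\<not> (xor3 ^^ t) ?g (?ys t)" if "t \<le> Suc s" for t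
    using that xs(3)[of t] by (cases "t = Suc s") auto
  moreover have "mv ((xor3 ^^ t) ?g) (?ys t) (?ys (Suc t))" if "t < Suc s" for t
    using that xs(2)[of t] xs(1) x(1) by (cases "t = s") auto
  ultimately show ?case by (intro exI[of _ ?ys]) auto
qed

lemma forward_cone_slab:
  assumes "(y, s) \<in> forward_cone ({0..L} \<times> {T})"
  shows "T \<le> s" "int T - int s \<le> y" "y \<le> L + int s - int T"
  using assms by (auto simp: forward_cone_def point_cone_def)

section \<open>Random seeds and the depth of the cone\<close>

lemma map_random_binary_seed:
  "map_pmf (\<lambda>\<xi> x. \<xi> x = S1) (random_binary_seed L) = fair 0 (int L)"
proof -
  have "map_pmf (\<lambda>s. s = S1) (pmf_of_set {S0, S1}) = pmf_of_set ((\<lambda>s. s = S1) ` {S0, S1})"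
    by (rule map_pmf_of_set_inj) (auto simp: inj_on_def)
  also have "(\<lambda>s. s = S1) ` {S0, S1} = UNIV" by auto
  finally show ?thesis
    unfolding random_binary_seed_def fair_Pi_pmf
    using Pi_pmf_map[of "{0..int L}" "\<lambda>s. s = S1" S0 False "\<lambda>_. pmf_of_set {S0, S1}"]
    by (simp add: comp_def)
qed

lemma evolve_no_twos:
  assumes "no_spontaneous_birth f" "\<And>x. \<xi> x \<noteq> S2"
  shows "evolve f \<xi> t x \<noteq> S2"
proof (induction t arbitrary: x)
  case (Suc t)
  then show ?case using assms(1) unfolding no_spontaneous_birth_def by (metis One_nat_def evolve.simps)
qed (use assms in auto)

lemma random_binary_seed_support:
  assumes "\<xi> \<in> set_pmf (random_binary_seed L)"
  shows "\<xi> x \<noteq> S2"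
proof -
  have "set_pmf (random_binary_seed L) \<subseteq> PiE_dflt {0..int L} S0 (\<lambda>_. {S0, S1})"
    unfolding random_binary_seed_def using set_Pi_pmf_subset'[of "{0..int L}" S0 "\<lambda>_. pmf_of_set {S0, S1}"]
    by (simp add: comp_def)
  then have "\<xi> x \<in> (if x \<in> {0..int L} then {S0, S1} else {S0})"
    using assms by (fastforce simp: PiE_dflt_def)
  then show ?thesis by (auto split: if_splits)
qed

text \<open>With \<open>n\<close> about a quarter of the depth of the cone, this rate makes \<open>(15/16) ^ n\<close> of order
  \<open>1 / L\<^sup>2\<close>.\<close>

definition cone_rate :: real where
  "cone_rate = 8 / ln (16/15)"

definition cone_depth :: "nat \<Rightarrow> nat" where
  "cone_depth L = nat \<lfloor>cone_rate * ln (real L)\<rfloor>"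

lemma cone_rate_ge: "cone_rate \<ge> 8"
proof -
  have "ln (16/15 :: real) \<le> 1" using ln_le_minus_one[of "16/15 :: real"] by simp
  moreover have "0 < ln (16/15 :: real)" by simp
  ultimately show ?thesis by (simp add: cone_rate_def field_simps)
qed

lemma cone_depth_decay:
  assumes L: "3 \<le> L" and n: "n = (cone_depth L - 1) div 4"
  shows "4 * n + 1 \<le> cone_depth L" "(15/16) ^ n \<le> 2 / (real L)\<^sup>2"
proof -
  let ?\<kappa> = "ln (16/15 :: real)"
  have k0: "0 < ?\<kappa>" by simp
  have "exp 1 \<le> real L" using exp_le L by linarith
  then have ln1: "1 \<le> ln (real L)" using L by (subst ln_ge_iff) auto
  then have pos: "8 \<le> cone_rate * ln (real L)"
    using mult_mono[of 8 cone_rate 1 "ln (real L)"] cone_rate_ge by simp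
  then have depth: "cone_rate * ln (real L) - 1 < real (cone_depth L)"
    unfolding cone_depth_def by linarith
  then have "8 \<le> cone_depth L" using pos by linarith
  then show "4 * n + 1 \<le> cone_depth L" using n by linarith
  have "cone_depth L \<le> 4 * n + 4" using n by linarith
  \<comment> \<open>The 5 is made up of 1 lost to the floor and 4 lost to the subtraction and the
    integer division.\<close>
  then have "cone_rate * ln (real L) - 5 \<le> 4 * real n" using depth by linarith
  then have "(cone_rate * ln (real L) - 5) * ?\<kappa> \<le> 4 * real n * ?\<kappa>"
    using k0 by (intro mult_right_mono) auto
  moreover have rate: "cone_rate * ?\<kappa> = 8" using k0 by (simp add: cone_rate_def)
  have "(cone_rate * ln (real L) - 5) * ?\<kappa> = cone_rate * ?\<kappa> * ln (real L) - 5 * ?\<kappa>"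
    by algebra
  then have "(cone_rate * ln (real L) - 5) * ?\<kappa> = 8 * ln (real L) - 5 * ?\<kappa>"
    unfolding rate .
  ultimately have "8 * ln (real L) - 5 * ?\<kappa> \<le> 4 * (real n * ?\<kappa>)" by (simp only: mult.assoc)
  \<comment> \<open>Division by 4 leaves \<open>5/4\<close>, rounded up to 2 so that the constant
    becomes \<open>(16/15)^2\<close>, which is below 2.\<close>
  then have "- (real n * ?\<kappa>) \<le> 2 * ?\<kappa> - 2 * ln (real L)" using k0 by linarith
  then have "exp (- (real n * ?\<kappa>)) \<le> exp (2 * ?\<kappa> - 2 * ln (real L))" by simp
  also have "\<dots> = (exp ?\<kappa>)\<^sup>2 / (exp (ln (real L)))\<^sup>2"
    by (simp only: exp_diff exp_double)
  also have "\<dots> = (16/15)\<^sup>2 / (real L)\<^sup>2" using L by simp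
  also have "\<dots> \<le> 2 / (real L)\<^sup>2"
    by (intro divide_right_mono) (auto simp: power2_eq_square)
  also have "exp (- (real n * ?\<kappa>)) = (15/16) ^ n"
  proof -
    have "exp (real n * - ?\<kappa>) = exp (- ?\<kappa>) ^ n" by (rule exp_of_nat_mult)
    moreover have "exp (- ?\<kappa>) = 15/16" by (simp add: exp_minus)
    ultimately show ?thesis by simp
  qed
  finally show "(15/16) ^ n \<le> 2 / (real L)\<^sup>2" .
qed

text \<open>Supplies, for large \<open>L\<close>, the bound \<open>4 * n + 1 \<le> L\<close> that
  the union bound asks for.\<close>

lemma eventually_cone_depth_le: "eventually (\<lambda>L. cone_depth L \<le> L) sequentially"
proof -
  have "((\<lambda>L. ln (real L) / real L) \<longlonglongrightarrow> 0)"
    by (rule filterlim_compose[OF ln_x_over_x_tendsto_0 filterlim_real_sequentially])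
  moreover have "0 < 1 / cone_rate" using cone_rate_ge by simp
  ultimately have "eventually (\<lambda>L. ln (real L) / real L < 1 / cone_rate) sequentially"
    by (rule order_tendstoD(2))
  then show ?thesis
    using eventually_gt_at_top[of 0]
  proof eventually_elim
    case (elim L)
    have "cone_rate * ln (real L) \<le> real L" using elim cone_rate_ge by (simp add: field_simps)
    then show ?case unfolding cone_depth_def by linarith
  qed
qed

section \<open>Convergence of the probabilities\<close>

lemma prob_agreement:
  assumes web: "web_CA f" and mv: "mv = diag_move \<or> mv = wide_move"
    and step: "discrepancies_follow mv f"
    and L: "3 \<le> L" "cone_depth L \<le> L"
  shows "1 - 240 / real L \<le> measure_pmf.prob (random_binary_seed L)
         {\<xi>. \<forall>D. D \<subseteq> {x. \<xi> x = S0} \<longrightarrow>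
            (\<forall>(y, s) \<in> forward_cone ({0..int L} \<times> {cone_depth L}).
               evolve f (put_twos D \<xi>) s y = evolve f \<xi> s y)}"
proof -
  define n where "n = (cone_depth L - 1) div 4"
  note depth = cone_depth_decay[OF L(1) n_def]
  let ?bad = "{\<xi>. seed_survival mv n (int L) (\<lambda>x. \<xi> x = S1)}"
  \<comment> \<open>The period has to exceed \<open>4 * n + 1\<close>; the next power of two does so
    and is at most twice as large.\<close>
  obtain q where q: "2 ^ q \<le> 4 * n + 1" "4 * n + 1 < 2 ^ (q + 1)"
    using ex_power_ivl1[of 2 "4 * n + 1"] by auto
  have q': "4 * int n + 1 < 2 ^ (q + 1)" "2 ^ (q + 1) \<le> 8 * int n + 2"
  proof -
    have "int (4 * n + 1) < int (2 ^ (q + 1))" using q(2) by (rule of_nat_less_iff[THEN iffD2])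
    then show "4 * int n + 1 < 2 ^ (q + 1)" by simp
    have "int (2 ^ q) \<le> int (4 * n + 1)" using q(1) by (rule of_nat_le_iff[THEN iffD2])
    then show "2 ^ (q + 1) \<le> 8 * int n + 2" by simp
  qed
  have "measure_pmf.prob (random_binary_seed L) ?bad =
      measure_pmf.prob (fair 0 (int L)) {g. seed_survival mv n (int L) g}"
    unfolding map_random_binary_seed[symmetric] by (simp add: vimage_def)
  also have "\<dots> \<le> 20 * (real L + 1) * (3 * (15/16) ^ n)"
    using q' depth(1) L by (intro prob_seed_survival[OF mv, where m = "q + 1"]) auto
  also have "\<dots> \<le> 20 * (2 * real L) * (3 * (2 / (real L)\<^sup>2))"
    using depth(2) L by (intro mult_mono) auto
  also have "\<dots> = 240 / real L" using L by (simp add: power2_eq_square)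
  finally have "1 - 240 / real L \<le> 1 - measure_pmf.prob (random_binary_seed L) ?bad" by simp
  also have "\<dots> = measure_pmf.prob (random_binary_seed L) (- ?bad)"
    using measure_pmf.prob_compl[of ?bad "random_binary_seed L"] by (simp add: Compl_eq_Diff_UNIV)
  also have "\<dots> \<le> measure_pmf.prob (random_binary_seed L)
         {\<xi>. \<forall>D. D \<subseteq> {x. \<xi> x = S0} \<longrightarrow>
            (\<forall>(y, s) \<in> forward_cone ({0..int L} \<times> {cone_depth L}).
               evolve f (put_twos D \<xi>) s y = evolve f \<xi> s y)}"
  proof (rule measure_pmf.finite_measure_mono, rule subsetI)
    \<comment> \<open>The exceptional event involves only the 1s of \<open>\<xi>\<close>, so
      avoiding it serves all sets \<open>D\<close> at once.\<close>
    fix \<xi> assume good: "\<xi> \<in> - ?bad"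
    have "evolve f (put_twos D \<xi>) s y = evolve f \<xi> s y"
      if D: "D \<subseteq> {x. \<xi> x = S0}" and cone: "(y, s) \<in> forward_cone ({0..int L} \<times> {cone_depth L})"
      for D y s
    proof (rule ccontr)
      assume diff: "evolve f (put_twos D \<xi>) s y \<noteq> evolve f \<xi> s y"
      have ones: "\<xi> x = S1 \<longleftrightarrow> put_twos D \<xi> x = S1" for x
        using D by (auto simp: put_twos_def)
      obtain xs where "xs s = y"
          "\<And>t. t < s \<Longrightarrow> mv ((xor3 ^^ t) (\<lambda>x. \<xi> x = S1)) (xs t) (xs (Suc t))"
          "\<And>t. t \<le> s \<Longrightarrow> \<not> (xor3 ^^ t) (\<lambda>x. \<xi> x = S1) (xs t)"
        using discrepancy_path[of f mv \<xi> "put_twos D \<xi>" s y, OF web step ones] diff by metis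
      then have "seed_survival mv n (int L) (\<lambda>x. \<xi> x = S1)"
        using path_seed_survival[of mv s "\<lambda>x. \<xi> x = S1" xs n "cone_depth L" "int L", OF mv]
          depth(1) forward_cone_slab[OF cone] by blast
      then show False using good by simp
    qed
    then show "\<xi> \<in> {\<xi>. \<forall>D. D \<subseteq> {x. \<xi> x = S0} \<longrightarrow>
            (\<forall>(y, s) \<in> forward_cone ({0..int L} \<times> {cone_depth L}).
               evolve f (put_twos D \<xi>) s y = evolve f \<xi> s y)}" by blast
  qed simp
  finally show ?thesis .
qed

lemma prob_agreement_tendsto:
  assumes "web_CA f" "diagonal_compliant f \<or> wide_compliant f"
  shows "(\<lambda>L. measure_pmf.prob (random_binary_seed L)
         {\<xi>. \<forall>D. D \<subseteq> {x. \<xi> x = S0} \<longrightarrow>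
            (\<forall>(y, s) \<in> forward_cone ({0..int L} \<times> {cone_depth L}).
               evolve f (put_twos D \<xi>) s y = evolve f \<xi> s y)}) \<longlonglongrightarrow> 1"
proof (rule tendsto_sandwich)
  obtain mv where mv: "mv = diag_move \<or> mv = wide_move" and step: "discrepancies_follow mv f"
    using assms(2) diagonal_compliant_discrepancies wide_compliant_discrepancies by blast
  show "\<forall>\<^sub>F L in sequentially. 1 - 240 / real L \<le> measure_pmf.prob (random_binary_seed L)
         {\<xi>. \<forall>D. D \<subseteq> {x. \<xi> x = S0} \<longrightarrow>
            (\<forall>(y, s) \<in> forward_cone ({0..int L} \<times> {cone_depth L}).
               evolve f (put_twos D \<xi>) s y = evolve f \<xi> s y)}"
    using eventually_cone_depth_le eventually_ge_at_top[of 3]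
    by eventually_elim (rule prob_agreement[OF assms(1) mv step])
  show "(\<lambda>L. 1 - 240 / real L) \<longlonglongrightarrow> 1"
    using tendsto_diff[OF tendsto_const lim_const_over_n[of 240], of 1] by simp
qed auto

text \<open>Seeds in the support contain no 2s, and without spontaneous birth neither do their
  evolutions; agreement passes this on to the changed seed. So the probability of agreement is a
  lower bound.\<close>

lemma prob_no_twos_tendsto:
  assumes "web_CA f" "diagonal_compliant f \<or> wide_compliant f" "no_spontaneous_birth f"
  shows "(\<lambda>L. measure_pmf.prob (random_binary_seed L)
         {\<xi>. \<forall>D. D \<subseteq> {x. \<xi> x = S0} \<longrightarrow>
            (\<forall>(y, s) \<in> forward_cone ({0..int L} \<times> {cone_depth L}).
               evolve f (put_twos D \<xi>) s y \<noteq> S2)}) \<longlonglongrightarrow> 1"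
proof (rule tendsto_sandwich[OF always_eventually always_eventually
      prob_agreement_tendsto[OF assms(1,2)] tendsto_const], safe)
  fix L
  let ?A = "{\<xi>. \<forall>D. D \<subseteq> {x. \<xi> x = S0} \<longrightarrow>
            (\<forall>(y, s) \<in> forward_cone ({0..int L} \<times> {cone_depth L}).
               evolve f (put_twos D \<xi>) s y = evolve f \<xi> s y)}"
  let ?B = "{\<xi>. \<forall>D. D \<subseteq> {x. \<xi> x = S0} \<longrightarrow>
            (\<forall>(y, s) \<in> forward_cone ({0..int L} \<times> {cone_depth L}).
               evolve f (put_twos D \<xi>) s y \<noteq> S2)}"
  have "measure_pmf.prob (random_binary_seed L) ?A
      = measure_pmf.prob (random_binary_seed L) (?A \<inter> set_pmf (random_binary_seed L))"
    by (rule measure_Int_set_pmf[symmetric])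
  also have "\<dots> \<le> measure_pmf.prob (random_binary_seed L) ?B"
  proof (rule measure_pmf.finite_measure_mono, rule subsetI)
    fix \<xi> assume \<xi>: "\<xi> \<in> ?A \<inter> set_pmf (random_binary_seed L)"
    then have "\<xi> x \<noteq> S2" for x using random_binary_seed_support by blast
    then have "evolve f \<xi> s y \<noteq> S2" for s y by (rule evolve_no_twos[OF assms(3)])
    moreover have "evolve f (put_twos D \<xi>) s y = evolve f \<xi> s y"
      if "D \<subseteq> {x. \<xi> x = S0}" "(y, s) \<in> forward_cone ({0..int L} \<times> {cone_depth L})" for D y s
      using \<xi> that by blast
    ultimately have "evolve f (put_twos D \<xi>) s y \<noteq> S2"
      if "D \<subseteq> {x. \<xi> x = S0}" "(y, s) \<in> forward_cone ({0..int L} \<times> {cone_depth L})" for D y s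
      using that by metis
    then show "\<xi> \<in> ?B" by blast
  qed simp
  finally show "measure_pmf.prob (random_binary_seed L) ?A
      \<le> measure_pmf.prob (random_binary_seed L) ?B" .
qed simp

theorem theorem1p4:
  "\<exists>C::real. C > 0 \<and>
    (\<forall>f. web_CA f \<and> (diagonal_compliant f \<or> wide_compliant f) \<longrightarrow>
      (\<lambda>L::nat. measure_pmf.prob (random_binary_seed L)
         {\<xi>. \<forall>D. D \<subseteq> {x. \<xi> x = S0} \<longrightarrow>
            (\<forall>(y, s) \<in> forward_cone ({0..int L} \<times> {nat \<lfloor>C * ln (real L)\<rfloor>}).
               evolve f (put_twos D \<xi>) s y = evolve f \<xi> s y)}) \<longlonglongrightarrow> 1 \<and>
      (no_spontaneous_birth f \<longrightarrow>
        (\<lambda>L::nat. measure_pmf.prob (random_binary_seed L)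
           {\<xi>. \<forall>D. D \<subseteq> {x. \<xi> x = S0} \<longrightarrow>
              (\<forall>(y, s) \<in> forward_cone ({0..int L} \<times> {nat \<lfloor>C * ln (real L)\<rfloor>}).
                 evolve f (put_twos D \<xi>) s y \<noteq> S2)}) \<longlonglongrightarrow> 1))"
proof (intro exI[of _ cone_rate] conjI allI impI)
  show "cone_rate > 0" using cone_rate_ge by simp
qed (unfold cone_depth_def[symmetric], auto intro!: prob_agreement_tendsto prob_no_twos_tendsto)

end
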